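(* Let $W,V>1$, $M\ge 1$ and $r\in(0,1]$. Algorithm SA$^*$ (described in the context), with admittance probability $r$, with $\ell_W$ work-classes of maximal within-class ratio $\delta_W$ and $\ell_V$ profit-classes of maximal within-class ratio $\delta_V$, and with any internal ordering within the set of $G^K$-packets and within the set of non-$G^K$-packets, is $$O\left(\left[\frac{M}{r}+\delta_W\cdot\delta_V\right]\cdot\ell_W\cdot\ell_V\right)\text{-competitive},$$ i.e. there is a universal constant $C$ such that for every finite arrival sequence with at most $M$ unknown packets per cycle, the throughput of any offline algorithm is at most $C\left[\frac{M}{r}+\delta_W\delta_V\right]\ell_W\ell_V$ times the expected throughput of SA$^*$.
   Context: Model. Time is divided into discrete cycles, each consisting of three steps: (i) transmission: fully processed packets leave the queue; (ii) arrival: new packets may arrive one after the other, and the algorithm decides which to accept and which currently buffered packets to push out and drop; (iii) processing: a single buffered packet receives one processing cycle. The buffer (of the online and of the offline algorithm) holds at most $B\ge 2$ packets. Packets have unit size; packet $p$ has profit $v(p)\in\{1,\dots,V\}$ (gained when transmitted) and work $w(p)\in\{1,\dots,W\}$ (number of processing cycles needed before transmission). On arrival the characteristics $(w(p),v(p))$ are either known (a $K$-packet) or unknown (a $U$-packet); those of a $U$-packet become known once it undergoes its first processing cycle, which counts as one of its $w(p)$ cycles. At most $M$ $U$-packets arrive per cycle. Throughput is the total profit of all packets eventually transmitted. Offline algorithms know the whole arrival sequence and all characteristics. Classes. The set $\{1,\dots,W\}$ is partitioned into $\ell_W$ work-classes, each a range of consecutive values, indexed in increasing order of work, and the set $\{1,\dots,V\}$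 into $\ell_V$ profit-classes, each a range of consecutive values, indexed in increasing order of profit; $\delta_W$ (resp. $\delta_V$) is the maximal ratio between two work (resp. profit) values in the same class. A packet is in $C_{(i,j)}$ if its total work $w(p)$ (not the remaining work) is in work-class $i$ and its profit is in profit-class $j$. The $(i,j)$-closure class is $C^*_{(i,j)}=\bigcup_{i'\le i,\ j'\ge j}C_{(i',j')}$. Algorithm SA$^*$. At initialization pick $i^*\in\{1,\dots,\ell_W\}$ and $j^*\in\{1,\dots,\ell_V\}$ independently and uniformly at random; the selected class is $G=C^*_{(i^*,j^* )}$. A $G^K$-packet is a packet in $G$ whose characteristics are currently known. The buffer is Gfull if it contains $B$ $G^K$-packets. Priority order of buffered packets: the admitted packet (if any) first, then $G^K$-packets, then all other packets, with non-admitted unknown packets last; the order within the set of $G^K$-packets and within the remaining packets is given by a fixed rule (e.g. FIFO; non-decreasing remaining work with ties by non-increasing profit; or non-increasing profit-to-work ratio). "Making room" means: if the buffer is full, drop the lowest-priority packet. Fill phase: each cycle is independently declared an admittance cycle with probability $r$. Each arriving packet $p$ is handled thus: (a) if $p$ is a $G^K$-packet: if the buffer contains $B-1$ $G^K$-packets, drop the admitted packet if one exists; then make room and accept $p$; (b) if $p$ is a $U$-packet and the cycle is an admittance cycle: if $p$ is the first $U$-packet of this cycle, make room, accept it and mark it admitted; if it is the $m$-th, $m\ge 2$, then with probability $1/m$ it replaces the admitted packet; (c) if $p$ has not been accepted and the buffer is not full, accept $p$. In the processing step the highest-priority packet is processed and the mark "admitted" is removed. When the buffer becomes Gfull, the algorithm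 switches to the flush phase. Flush phase: the $B$ packets that were in the buffer when it became Gfull are never dropped, and only they are processed, until all of them are transmitted. Packets arriving during the flush phase may be accepted into free buffer space according to the same priorities as in the fill phase (possibly pushing out lower-priority packets that also arrived during this flush phase), but none of them is scheduled for processing before all these $B$ packets have been transmitted. After that the algorithm returns to the fill phase, keeping the packets accepted during the flush phase (and immediately enters a new flush phase if the buffer is Gfull). *)

theory Defs
  imports "HOL-Probability.Probability"
begin

record packet =
  work :: nat
  profit :: nat
  is_K :: bool  \<comment> \<open>True for a K-packet, False for a U-packet\<close>

text \<open>A packet is identified by its cycle of arrival and its position among the arrivals of that
  cycle, so that distinct packets with equal characteristics stay distinct.\<close>

type_synonym ident = "nat \<times> nat"

record item =
  ident :: ident
  pkt :: packet
  remaining :: nat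

text \<open>An arrival sequence is a list with one entry per cycle; the entry lists the packets of that
  cycle in their order of arrival. No packet arrives in the cycles after the end of the list.\<close>

type_synonym arrival_seq = "packet list list"

definition arrivals_at :: "arrival_seq \<Rightarrow> nat \<Rightarrow> item list" where
  "arrivals_at arr t =
     (if t < length arr
      then map (\<lambda>k. \<lparr>ident = (t, k), pkt = arr ! t ! k, remaining = work (arr ! t ! k)\<rparr>)
             [0..<length (arr ! t)]
      else [])"

definition valid_arrivals :: "nat \<Rightarrow> nat \<Rightarrow> nat \<Rightarrow> arrival_seq \<Rightarrow> bool" where
  "valid_arrivals W V M arr \<longleftrightarrow>
     (\<forall>ps\<in>set arr.
        (\<forall>p\<in>set ps. work p \<in> {1..W} \<and> profit p \<in> {1..V}) \<and>
        length (filter (\<lambda>p. \<not> is_K p) ps) \<le> M)"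

text \<open>The characteristics of a buffered packet are known if they were known on arrival or if the
  packet has received at least one processing cycle.\<close>

definition known :: "item \<Rightarrow> bool" where
  "known x \<longleftrightarrow> is_K (pkt x) \<or> remaining x < work (pkt x)"

text \<open>What an online algorithm can observe of a packet: its identity (that is, its arrival time),
  and, only if they are known, its work, its profit and its remaining work.\<close>

type_synonym view = "ident \<times> (nat \<times> nat \<times> nat) option"

definition view :: "item \<Rightarrow> view" where
  "view x = (ident x,
     if known x then Some (work (pkt x), profit (pkt x), remaining x) else None)"

definition process_item :: "item \<Rightarrow> item" where
  "process_item x = x\<lparr>remaining := remaining x - 1\<rparr>"

definition finished :: "item set \<Rightarrow> item set" where
  "finished S = {x \<in> S. remaining x = 0}"

definition total_profit :: "item set \<Rightarrow> nat" where
  "total_profit S = (\<Sum>x\<in>S. profit (pkt x))"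

text \<open>For each arriving packet an offline algorithm may drop any buffered packets and may accept or
  reject the new one, as long as at most B packets are in the buffer.\<close>

fun offline_arrivals :: "nat \<Rightarrow> item list \<Rightarrow> item set \<Rightarrow> item set \<Rightarrow> bool" where
  "offline_arrivals B [] S S' \<longleftrightarrow> S' = S"
| "offline_arrivals B (x # xs) S S' \<longleftrightarrow>
     (\<exists>T. T \<subseteq> insert x S \<and> card T \<le> B \<and> offline_arrivals B xs T S')"

definition offline_process :: "item set \<Rightarrow> item set \<Rightarrow> bool" where
  "offline_process S S' \<longleftrightarrow>
     S' = S \<or> (\<exists>x\<in>S. S' = insert (process_item x) (S - {x}))"

text \<open>\<open>\<sigma> t\<close> is the content of the buffer at the beginning of cycle t.\<close>

definition offline_schedule :: "nat \<Rightarrow> arrival_seq \<Rightarrow> (nat \<Rightarrow> item set) \<Rightarrow> bool" where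
  "offline_schedule B arr \<sigma> \<longleftrightarrow>
     \<sigma> 0 = {} \<and>
     (\<forall>t. \<exists>S. offline_arrivals B (arrivals_at arr t) (\<sigma> t - finished (\<sigma> t)) S \<and>
              offline_process S (\<sigma> (Suc t)))"

definition offline_throughput :: "(nat \<Rightarrow> item set) \<Rightarrow> ennreal" where
  "offline_throughput \<sigma> = (\<Sum>t. of_nat (total_profit (finished (\<sigma> t))))"

definition range_partition :: "nat \<Rightarrow> nat \<Rightarrow> (nat \<Rightarrow> nat set) \<Rightarrow> bool" where
  "range_partition N l C \<longleftrightarrow>
     (\<forall>i\<in>{1..l}. \<exists>a b. a \<le> b \<and> C i = {a..b}) \<and>
     (\<Union>i\<in>{1..l}. C i) = {1..N} \<and>
     (\<forall>i\<in>{1..l}. \<forall>j\<in>{1..l}. i < j \<longrightarrow> (\<forall>x\<in>C i. \<forall>y\<in>C j. x < y))"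

definition max_ratio :: "nat \<Rightarrow> (nat \<Rightarrow> nat set) \<Rightarrow> real" where
  "max_ratio l C = Max {real x / real y | x y i. i \<in> {1..l} \<and> x \<in> C i \<and> y \<in> C i}"

definition packet_class :: "(nat \<Rightarrow> nat set) \<Rightarrow> (nat \<Rightarrow> nat set) \<Rightarrow> nat \<Rightarrow> nat \<Rightarrow> packet set" where
  "packet_class CW CV i j = {p. work p \<in> CW i \<and> profit p \<in> CV j}"

definition closure_class ::
  "(nat \<Rightarrow> nat set) \<Rightarrow> nat \<Rightarrow> (nat \<Rightarrow> nat set) \<Rightarrow> nat \<Rightarrow> nat \<Rightarrow> packet set" where
  "closure_class CW lV CV i j = (\<Union>i'\<in>{1..i}. \<Union>j'\<in>{j..lV}. packet_class CW CV i' j')"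

text \<open>The orders \<open>order_GK\<close> and \<open>order_other\<close> are the internal orderings of the packets that are,
  respectively are not, GK-packets; a pair \<open>(u, v)\<close> means that u has priority over v. The predicate
  \<open>flush_accept\<close> resolves the freedom left during a flush phase: given the selected class, the
  packets of the flush that are still to be transmitted, the buffer and the new packet, it says
  whether the algorithm wants to accept the new packet if priorities and buffer space allow it.\<close>

record sa_params =
  capacity :: nat
  admit_prob :: real
  order_GK :: "view rel"
  order_other :: "view rel"
  flush_accept :: "packet set \<Rightarrow> ident set \<Rightarrow> view set \<Rightarrow> view \<Rightarrow> bool"

definition valid_sa_params :: "sa_params \<Rightarrow> bool" where
  "valid_sa_params P \<longleftrightarrow>
     2 \<le> capacity P \<and> 0 < admit_prob P \<and> admit_prob P \<le> 1 \<and>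
     linear_order (order_GK P) \<and> linear_order (order_other P)"

text \<open>The field \<open>flushing\<close> holds the packets of the current flush phase that have not been
  transmitted yet; the algorithm is in the fill phase iff this set is empty. The field \<open>gained\<close> is
  the total profit of the packets transmitted so far.\<close>

record sa_state =
  buffer :: "item set"
  admitted :: "ident option"
  flushing :: "ident set"
  gained :: nat

definition sa_init :: sa_state where
  "sa_init = \<lparr>buffer = {}, admitted = None, flushing = {}, gained = 0\<rparr>"

definition GK :: "packet set \<Rightarrow> item \<Rightarrow> bool" where
  "GK G x \<longleftrightarrow> pkt x \<in> G \<and> known x"

definition priority_level :: "packet set \<Rightarrow> sa_state \<Rightarrow> item \<Rightarrow> nat" where
  "priority_level G s x =
     (if admitted s = Some (ident x) then 0
      else if GK G x then 1
      else if known x then 2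
      else 3)"

definition precedes :: "sa_params \<Rightarrow> packet set \<Rightarrow> sa_state \<Rightarrow> item \<Rightarrow> item \<Rightarrow> bool" where
  "precedes P G s x y \<longleftrightarrow>
     priority_level G s x < priority_level G s y \<or>
     priority_level G s x = priority_level G s y \<and>
       (view x, view y) \<in> (if GK G x then order_GK P else order_other P)"

definition highest :: "sa_params \<Rightarrow> packet set \<Rightarrow> sa_state \<Rightarrow> item set \<Rightarrow> item" where
  "highest P G s S = (THE x. x \<in> S \<and> (\<forall>y\<in>S. precedes P G s x y))"

definition lowest :: "sa_params \<Rightarrow> packet set \<Rightarrow> sa_state \<Rightarrow> item set \<Rightarrow> item" where
  "lowest P G s S = (THE x. x \<in> S \<and> (\<forall>y\<in>S. precedes P G s y x))"

definition full :: "sa_params \<Rightarrow> sa_state \<Rightarrow> bool" where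
  "full P s \<longleftrightarrow> card (buffer s) \<ge> capacity P"

definition num_GK :: "packet set \<Rightarrow> sa_state \<Rightarrow> nat" where
  "num_GK G s = card {x \<in> buffer s. GK G x}"

definition accept :: "item \<Rightarrow> sa_state \<Rightarrow> sa_state" where
  "accept x s = s\<lparr>buffer := insert x (buffer s)\<rparr>"

definition accept_if_space :: "sa_params \<Rightarrow> item \<Rightarrow> sa_state \<Rightarrow> sa_state" where
  "accept_if_space P x s = (if full P s then s else accept x s)"

definition make_room :: "sa_params \<Rightarrow> packet set \<Rightarrow> sa_state \<Rightarrow> sa_state" where
  "make_room P G s =
     (if full P s then s\<lparr>buffer := buffer s - {lowest P G s (buffer s)}\<rparr> else s)"

definition drop_admitted :: "sa_state \<Rightarrow> sa_state" where
  "drop_admitted s =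
     s\<lparr>buffer := {x \<in> buffer s. admitted s \<noteq> Some (ident x)}, admitted := None\<rparr>"

definition start_flush_if_Gfull :: "sa_params \<Rightarrow> packet set \<Rightarrow> sa_state \<Rightarrow> sa_state" where
  "start_flush_if_Gfull P G s =
     (if flushing s = {} \<and> num_GK G s = capacity P
      then s\<lparr>flushing := ident ` buffer s\<rparr> else s)"

definition transmit :: "sa_params \<Rightarrow> packet set \<Rightarrow> sa_state \<Rightarrow> sa_state" where
  "transmit P G s =
     (let D = finished (buffer s) in
      start_flush_if_Gfull P G
        (s\<lparr>buffer := buffer s - D,
           flushing := flushing s - ident ` D,
           gained := gained s + total_profit D\<rparr>))"

text \<open>The flag \<open>adm\<close> says whether the cycle is an admittance cycle. If x is unknown, then m is its
  position among the U-packets of the cycle.\<close>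

definition fill_arrival ::
  "sa_params \<Rightarrow> packet set \<Rightarrow> bool \<Rightarrow> nat \<Rightarrow> item \<Rightarrow> sa_state \<Rightarrow> sa_state pmf" where
  "fill_arrival P G adm m x s =
     (if GK G x then
        return_pmf (start_flush_if_Gfull P G
          (accept x (make_room P G
            (if num_GK G s = capacity P - 1 then drop_admitted s else s))))
      else if \<not> known x \<and> adm then
        (if m = 1 then
           return_pmf ((accept x (make_room P G s))\<lparr>admitted := Some (ident x)\<rparr>)
         else
           map_pmf (\<lambda>replace.
               if replace then (accept x (drop_admitted s))\<lparr>admitted := Some (ident x)\<rparr>
               else accept_if_space P x s)
             (bernoulli_pmf (1 / real m)))
      else return_pmf (accept_if_space P x s))"

text \<open>During a flush phase the packets in \<open>flushing s\<close> are protected, and every other buffered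
  packet has arrived during this flush phase.\<close>

definition flush_arrival :: "sa_params \<Rightarrow> packet set \<Rightarrow> item \<Rightarrow> sa_state \<Rightarrow> sa_state" where
  "flush_arrival P G x s =
     (let U = {y \<in> buffer s. ident y \<notin> flushing s}; l = lowest P G s U in
      if \<not> flush_accept P G (flushing s) (view ` buffer s) (view x) then s
      else if \<not> full P s then accept x s
      else if U \<noteq> {} \<and> precedes P G s x l then accept x (s\<lparr>buffer := buffer s - {l}\<rparr>)
      else s)"

text \<open>The argument u is the number of U-packets that have already arrived in the current cycle.\<close>

fun sa_arrivals ::
  "sa_params \<Rightarrow> packet set \<Rightarrow> bool \<Rightarrow> nat \<Rightarrow> item list \<Rightarrow> sa_state \<Rightarrow> sa_state pmf" where
  "sa_arrivals P G adm u [] s = return_pmf s"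
| "sa_arrivals P G adm u (x # xs) s =
     (let m = (if known x then u else Suc u) in
      bind_pmf
        (if flushing s = {} then fill_arrival P G adm m x s
         else return_pmf (flush_arrival P G x s))
        (sa_arrivals P G adm m xs))"

definition sa_process :: "sa_params \<Rightarrow> packet set \<Rightarrow> sa_state \<Rightarrow> sa_state" where
  "sa_process P G s =
     (let S = (if flushing s = {} then buffer s else {x \<in> buffer s. ident x \<in> flushing s});
          h = highest P G s S
      in start_flush_if_Gfull P G
           (s\<lparr>buffer := (if S = {} then buffer s else insert (process_item h) (buffer s - {h})),
              admitted := None\<rparr>))"

definition sa_cycle ::
  "sa_params \<Rightarrow> packet set \<Rightarrow> item list \<Rightarrow> sa_state \<Rightarrow> sa_state pmf" where
  "sa_cycle P G xs s =
     bind_pmf (bernoulli_pmf (admit_prob P)) (\<lambda>adm.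
       map_pmf (sa_process P G) (sa_arrivals P G adm 0 xs (transmit P G s)))"

fun sa_run :: "sa_params \<Rightarrow> packet set \<Rightarrow> arrival_seq \<Rightarrow> nat \<Rightarrow> sa_state pmf" where
  "sa_run P G arr 0 = return_pmf sa_init"
| "sa_run P G arr (Suc n) = bind_pmf (sa_run P G arr n) (sa_cycle P G (arrivals_at arr n))"

definition sa_star ::
  "sa_params \<Rightarrow> nat \<Rightarrow> (nat \<Rightarrow> nat set) \<Rightarrow> nat \<Rightarrow> (nat \<Rightarrow> nat set) \<Rightarrow> arrival_seq \<Rightarrow> nat \<Rightarrow>
   sa_state pmf" where
  "sa_star P lW CW lV CV arr n =
     bind_pmf (pmf_of_set {1..lW}) (\<lambda>i.
       bind_pmf (pmf_of_set {1..lV}) (\<lambda>j.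
         sa_run P (closure_class CW lV CV i j) arr n))"

text \<open>The profit gained in n cycles is non-decreasing in n, so the supremum is the expectation of
  the total profit of all packets that are eventually transmitted.\<close>

definition sa_expected_throughput ::
  "sa_params \<Rightarrow> nat \<Rightarrow> (nat \<Rightarrow> nat set) \<Rightarrow> nat \<Rightarrow> (nat \<Rightarrow> nat set) \<Rightarrow> arrival_seq \<Rightarrow> ennreal" where
  "sa_expected_throughput P lW CW lV CV arr =
     (SUP n. \<integral>\<^sup>+ s. of_nat (gained s) \<partial>measure_pmf (sa_star P lW CW lV CV arr n))"

definition competitive ::
  "nat \<Rightarrow> nat \<Rightarrow> nat \<Rightarrow> nat \<Rightarrow> (arrival_seq \<Rightarrow> ennreal) \<Rightarrow> real \<Rightarrow> bool" where
  "competitive W V M B expected_alg c \<longleftrightarrow>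
     (\<forall>arr \<sigma>. valid_arrivals W V M arr \<longrightarrow> offline_schedule B arr \<sigma> \<longrightarrow>
        offline_throughput \<sigma> \<le> ennreal c * expected_alg arr)"

end

(*
  Fix the selected class G, the closure of C_(i,j), and charge the offline profit obtained from
  C_(i,j) alone; averaging over the lW * lV choices then gives the theorem.

  A known packet of G arriving in a fill phase is never lost by SA*, so it pays for itself. An unknown
  packet arriving in a cycle without flushing becomes the admitted packet with probability at least
  r/M by reservoir sampling; it is then processed at once and never lost either. Hence the offline
  profit of those cycles is at most M/r times the expected increase of the secured profit.
  A flush phase transmits B packets of G, each of profit at least c = min of the profit class, and
  lasts at most B * b cycles, where b = max of the work class. In that time the offline algorithm can
  complete at most B * b / a newly arrived packets of C_(i,j), where a = min of the work class, and keep
  B further ones in its buffer, each of profit at most d = max of the profit class. So the flush phase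
  pays for them up to the factor (b/a + 1) * d / c, which is at most 2 * delta_W * delta_V.

  The two accounts are combined into one potential whose expectation does not decrease.
*)
theory Submission
  imports Defs
begin

section \<open>Priorities\<close>

text \<open>The obstacle is that the cycles covered by flush phases depend on the random choices of
  the algorithm, so the two accounts cannot be settled over two fixed sets of cycles. The potential
  settles them cycle by cycle, given the current state: offline profit is booked under the arrival
  cycle of its packets and is either prepaid by the flush under way or paid on the spot. This works
  because no cycle mixes the cases: the state at its beginning and its arrivals decide whether
  processing takes place in a flush phase. If it does, the potential does not decrease in any
  outcome; otherwise only its expectation is controlled. The same transmitted profit may back both
  accounts, once with weight \<open>al\<close> and once with weight \<open>be\<close>; hence the sum
  of the two terms in the bound. A closure class is suitable because SA* only needs little work and
  much profit from the packets that it collects. The opposite bounds, work at least a and profit at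
  most d, are asked only of the offline packets, which come from the single class. Finally, all
  supports are finite, and after a fixed number of cycles the buffer is empty; limits enter only in
  the last comparison.\<close>

lemma finite_total_preorder_has_least:
  assumes "finite S" "S \<noteq> {}"
    and total: "\<And>x y. x \<in> S \<Longrightarrow> y \<in> S \<Longrightarrow> R x y \<or> R y x"
    and trans: "\<And>x y z. x \<in> S \<Longrightarrow> y \<in> S \<Longrightarrow> z \<in> S \<Longrightarrow> R x y \<Longrightarrow> R y z \<Longrightarrow> R x z"
  shows "\<exists>x\<in>S. \<forall>y\<in>S. R x y"
  using assms
proof (induction S rule: finite_ne_induct)
  case (singleton x)
  show ?case using singleton.prems(1)[of x x] by simp
next
  case (insert a F)
  have "\<exists>x\<in>F. \<forall>y\<in>F. R x y"
  proof (rule insert.IH)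
    show "R x y \<or> R y x" if "x \<in> F" "y \<in> F" for x y
      using that by (intro insert.prems(1)) auto
    show "R x z" if "x \<in> F" "y \<in> F" "z \<in> F" "R x y" "R y z" for x y z
      using that by (intro insert.prems(2)[of x y z]) auto
  qed
  then obtain m where m: "m \<in> F" "\<forall>y\<in>F. R m y" by blast
  have refl: "R a a" using insert.prems(1)[of a a] by simp
  show ?case
  proof (cases "R m a")
    case True
    then show ?thesis using m by auto
  next
    case False
    then have am: "R a m" using insert.prems(1)[of a m] m by auto
    have "R a y" if "y \<in> F" for y
      using insert.prems(2)[of a m y] am m that by auto
    then show ?thesis using refl by auto
  qed
qed

lemma view_eq_ident: "view x = view y \<Longrightarrow> ident x = ident y"
  by (simp add: view_def)

lemma precedes_total:
  assumes "valid_sa_params P" "inj_on ident S" "x \<in> S" "y \<in> S"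
  shows "precedes P G s x y \<or> precedes P G s y x"
proof (cases "priority_level G s x = priority_level G s y")
  case True
  have lin: "(u, v) \<in> order_GK P \<or> (v, u) \<in> order_GK P"
    "(u, v) \<in> order_other P \<or> (v, u) \<in> order_other P" for u v
    using assms(1) unfolding valid_sa_params_def linear_order_on_def partial_order_on_def
      preorder_on_def total_on_def refl_on_def by (metis UNIV_I)+
  show ?thesis
  proof (cases "x = y")
    case True
    then show ?thesis
      using lin(1)[of "view x" "view x"] lin(2)[of "view x" "view x"] by (auto simp: precedes_def)
  next
    case False
    then have "ident x \<noteq> ident y" using assms by (auto dest: inj_onD)
    then have "GK G x = GK G y"
      using True by (auto simp: priority_level_def split: if_splits)
    then show ?thesis
      using True lin(1)[of "view x" "view y"] lin(2)[of "view x" "view y"]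
      by (auto simp: precedes_def)
  qed
next
  case False
  then show ?thesis by (auto simp: precedes_def)
qed

text \<open>Levels 1 to 3 tell by themselves whether an item is a GK-item. Level 0 does not, but it
  holds at most one item, because identities in a buffer are distinct. Hence \<open>precedes\<close>
  never compares two items of one level by different orders.\<close>

lemma priority_level_eq_GK:
  assumes "inj_on ident S" "x \<in> S" "y \<in> S" "priority_level G s x = priority_level G s y"
  shows "GK G x = GK G y"
proof (cases "ident x = ident y")
  case True
  then show ?thesis using assms by (auto dest: inj_onD)
next
  case False
  then show ?thesis using assms(4) by (auto simp: priority_level_def split: if_splits)
qed

lemma precedes_trans:
  assumes "valid_sa_params P" "inj_on ident S" "x \<in> S" "y \<in> S" "z \<in> S"
    and "precedes P G s x y" "precedes P G s y z"
  shows "precedes P G s x z"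
proof -
  have tr: "trans (order_GK P)" "trans (order_other P)"
    using assms(1) unfolding valid_sa_params_def linear_order_on_def partial_order_on_def
      preorder_on_def by auto
  consider "priority_level G s x < priority_level G s z"
    | "priority_level G s x = priority_level G s y" "priority_level G s y = priority_level G s z"
    using assms(6,7) unfolding precedes_def by linarith
  then show ?thesis
  proof cases
    case 1
    then show ?thesis by (simp add: precedes_def)
  next
    case 2
    have "GK G x = GK G y" "GK G y = GK G z"
      using priority_level_eq_GK[OF assms(2)] assms(3-5) 2 by blast+
    then show ?thesis
      using 2 assms(6,7) transD[OF tr(1), of "view x" "view y" "view z"]
        transD[OF tr(2), of "view x" "view y" "view z"]
      by (simp add: precedes_def split: if_splits)
  qed
qed

text \<open>A view contains the identity even when the characteristics are hidden, so antisymmetry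
  of the orders on views carries over to items. This is what makes the descriptions in
  \<open>highest\<close> and \<open>lowest\<close> unique.\<close>

lemma precedes_antisym:
  assumes "valid_sa_params P" "inj_on ident S" "x \<in> S" "y \<in> S"
    and "precedes P G s x y" "precedes P G s y x"
  shows "x = y"
proof -
  have an: "antisym (order_GK P)" "antisym (order_other P)"
    using assms(1) unfolding valid_sa_params_def linear_order_on_def partial_order_on_def by auto
  have lev: "priority_level G s x = priority_level G s y"
    using assms(5,6) unfolding precedes_def by linarith
  then have "GK G x = GK G y"
    using priority_level_eq_GK[OF assms(2)] assms by blast
  then have "view x = view y"
    using lev assms(5,6) antisymD[OF an(1), of "view x" "view y"]
      antisymD[OF an(2), of "view x" "view y"]
    by (simp add: precedes_def split: if_splits)
  then show ?thesis using view_eq_ident assms by (metis inj_onD)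
qed

lemma highest_props:
  assumes "valid_sa_params P" "finite S" "S \<noteq> {}" "inj_on ident S"
  shows "highest P G s S \<in> S" "\<And>y. y \<in> S \<Longrightarrow> precedes P G s (highest P G s S) y"
proof -
  have "\<exists>x\<in>S. \<forall>y\<in>S. precedes P G s x y"
  proof (rule finite_total_preorder_has_least[OF assms(2,3)])
    show "precedes P G s x y \<or> precedes P G s y x" if "x \<in> S" "y \<in> S" for x y
      using precedes_total[OF assms(1,4) that] .
    show "precedes P G s x z"
      if "x \<in> S" "y \<in> S" "z \<in> S" "precedes P G s x y" "precedes P G s y z" for x y z
      using precedes_trans[OF assms(1,4) that] .
  qed
  then obtain m where m: "m \<in> S" "\<forall>y\<in>S. precedes P G s m y" by blast
  have "\<exists>!x. x \<in> S \<and> (\<forall>y\<in>S. precedes P G s x y)"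
  proof (rule ex1I[of _ m])
    show "x = m" if "x \<in> S \<and> (\<forall>y\<in>S. precedes P G s x y)" for x
      by (rule precedes_antisym[OF assms(1,4), of _ _ G s]) (use m that in auto)
  qed (use m in blast)
  from theI'[OF this]
  show "highest P G s S \<in> S" "\<And>y. y \<in> S \<Longrightarrow> precedes P G s (highest P G s S) y"
    unfolding highest_def by auto
qed

lemma lowest_props:
  assumes "valid_sa_params P" "finite S" "S \<noteq> {}" "inj_on ident S"
  shows "lowest P G s S \<in> S" "\<And>y. y \<in> S \<Longrightarrow> precedes P G s y (lowest P G s S)"
proof -
  have "\<exists>x\<in>S. \<forall>y\<in>S. precedes P G s y x"
  proof (rule finite_total_preorder_has_least[OF assms(2,3)])
    show "precedes P G s y x \<or> precedes P G s x y" if "x \<in> S" "y \<in> S" for x y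
      using precedes_total[OF assms(1,4) that(2,1)] .
    show "precedes P G s z x"
      if "x \<in> S" "y \<in> S" "z \<in> S" "precedes P G s y x" "precedes P G s z y" for x y z
      using precedes_trans[OF assms(1,4) that(3,2,1,5,4)] .
  qed
  then obtain m where m: "m \<in> S" "\<forall>y\<in>S. precedes P G s y m" by blast
  have "\<exists>!x. x \<in> S \<and> (\<forall>y\<in>S. precedes P G s y x)"
  proof (rule ex1I[of _ m])
    show "x = m" if "x \<in> S \<and> (\<forall>y\<in>S. precedes P G s y x)" for x
      by (rule precedes_antisym[OF assms(1,4), of _ _ G s]) (use m that in auto)
  qed (use m in blast)
  from theI'[OF this]
  show "lowest P G s S \<in> S" "\<And>y. y \<in> S \<Longrightarrow> precedes P G s y (lowest P G s S)"
    unfolding lowest_def by auto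
qed

lemma lowest_not_GK:
  assumes "valid_sa_params P" "finite S" "inj_on ident S"
    and "y \<in> S" "\<not> GK G y" "admitted s \<noteq> Some (ident y)"
  shows "lowest P G s S \<in> S" "\<not> GK G (lowest P G s S)"
    "admitted s \<noteq> Some (ident (lowest P G s S))"
proof -
  have ne: "S \<noteq> {}" using assms by auto
  show "lowest P G s S \<in> S" using lowest_props(1)[OF assms(1,2) ne assms(3)] .
  have "precedes P G s y (lowest P G s S)"
    using lowest_props(2)[OF assms(1,2) ne assms(3,4)] .
  then have "priority_level G s y \<le> priority_level G s (lowest P G s S)"
    unfolding precedes_def by linarith
  moreover have "2 \<le> priority_level G s y"
    using assms by (simp add: priority_level_def)
  ultimately have "2 \<le> priority_level G s (lowest P G s S)" by linarith
  then show "\<not> GK G (lowest P G s S)" "admitted s \<noteq> Some (ident (lowest P G s S))"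
    by (auto simp: priority_level_def split: if_splits)
qed

lemma highest_admitted:
  assumes "valid_sa_params P" "finite S" "inj_on ident S"
    and "y \<in> S" "admitted s = Some (ident y)"
  shows "highest P G s S = y"
proof -
  have ne: "S \<noteq> {}" using assms by auto
  have h: "highest P G s S \<in> S" using highest_props(1)[OF assms(1,2) ne assms(3)] .
  have "precedes P G s (highest P G s S) y"
    using highest_props(2)[OF assms(1,2) ne assms(3,4)] .
  then have "priority_level G s (highest P G s S) \<le> priority_level G s y"
    unfolding precedes_def by linarith
  then have "ident (highest P G s S) = ident y"
    using assms(5) by (auto simp: priority_level_def split: if_splits)
  then show ?thesis using h assms by (auto dest: inj_onD)
qed

section \<open>Secured profit and the flush phase\<close>

definition flush_items :: "sa_state \<Rightarrow> item set" where
  "flush_items s = {x \<in> buffer s. ident x \<in> flushing s}"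

definition GK_items :: "packet set \<Rightarrow> sa_state \<Rightarrow> item set" where
  "GK_items G s = {x \<in> buffer s. GK G x}"

text \<open>Packets whose profit can no longer be lost. During a flush phase, known packets of the selected
  class that arrived in that phase do not count, since they may still be pushed out.\<close>

definition guaranteed :: "packet set \<Rightarrow> sa_state \<Rightarrow> item set" where
  "guaranteed G s = (if flushing s = {} then GK_items G s else flush_items s)"

definition flush_work :: "sa_state \<Rightarrow> nat" where
  "flush_work s = sum remaining (flush_items s)"

definition secured :: "packet set \<Rightarrow> sa_state \<Rightarrow> nat" where
  "secured G s = gained s + total_profit (guaranteed G s)"

text \<open>Ignores GK-packets of the fill phase, so that the start of a flush phase shows up as a
  jump by the profit of the whole buffer. \<open>secured\<close> does not move at that
  moment.\<close>

definition flush_secured :: "sa_state \<Rightarrow> nat" where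
  "flush_secured s = gained s + total_profit (flush_items s)"

text \<open>Holds between transmission and processing. It makes the truncated subtraction in
  \<open>process_item\<close> remove a genuine unit of work, and an unknown packet become known when
  processed.\<close>

definition live :: "sa_state \<Rightarrow> bool" where
  "live s \<longleftrightarrow> (\<forall>x\<in>buffer s. 1 \<le> remaining x)"

definition admitted_unknown :: "sa_state \<Rightarrow> bool" where
  "admitted_unknown s \<longleftrightarrow> (\<forall>i. admitted s = Some i \<longrightarrow> (\<exists>x\<in>buffer s. ident x = i \<and> \<not> known x))"

lemma total_profit_mono: "finite B \<Longrightarrow> A \<subseteq> B \<Longrightarrow> total_profit A \<le> total_profit B"
  unfolding total_profit_def by (rule sum_mono2) auto

lemma total_profit_Un: "finite A \<Longrightarrow> finite B \<Longrightarrow> total_profit (A \<union> B) \<le> total_profit A + total_profit B"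
  unfolding total_profit_def by (simp add: sum_Un_nat)

lemma num_GK_eq: "num_GK G s = card (GK_items G s)"
  by (simp add: num_GK_def GK_items_def)

lemma GK_items_subset: "GK_items G s \<subseteq> buffer s"
  by (auto simp: GK_items_def)

lemma flush_items_subset: "flush_items s \<subseteq> buffer s"
  by (auto simp: flush_items_def)

lemma flush_items_fill [simp]: "flushing s = {} \<Longrightarrow> flush_items s = {}"
  by (auto simp: flush_items_def)

lemma flush_work_fill [simp]: "flushing s = {} \<Longrightarrow> flush_work s = 0"
  by (simp add: flush_work_def)

lemma flush_secured_fill: "flushing s = {} \<Longrightarrow> flush_secured s = gained s"
  by (simp add: flush_secured_def total_profit_def)

lemma secured_fill: "flushing s = {} \<Longrightarrow> secured G s = gained s + total_profit (GK_items G s)"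
  by (simp add: secured_def guaranteed_def)

lemma secured_flush: "flushing s \<noteq> {} \<Longrightarrow> secured G s = flush_secured s"
  by (simp add: secured_def guaranteed_def flush_secured_def)

locale selected_class =
  fixes P :: sa_params and G :: "packet set" and pk :: "ident \<Rightarrow> packet" and W b c :: nat
  assumes valid: "valid_sa_params P"
    and work_G: "q \<in> G \<Longrightarrow> work q \<le> b"
    and profit_G: "q \<in> G \<Longrightarrow> c \<le> profit q"
begin

abbreviation B :: nat where "B \<equiv> capacity P"

lemma B_ge_2: "2 \<le> B"
  using valid by (simp add: valid_sa_params_def)

definition item_ok :: "item \<Rightarrow> bool" where
  "item_ok x \<longleftrightarrow> pkt x = pk (ident x) \<and> 1 \<le> work (pkt x) \<and> work (pkt x) \<le> W \<and>
     remaining x \<le> work (pkt x)"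

definition buffer_ok :: "sa_state \<Rightarrow> bool" where
  "buffer_ok s \<longleftrightarrow> finite (buffer s) \<and> inj_on ident (buffer s) \<and> card (buffer s) \<le> B \<and>
     (\<forall>x\<in>buffer s. item_ok x) \<and> flushing s \<subseteq> ident ` buffer s"

definition state_ok :: "sa_state \<Rightarrow> bool" where
  "state_ok s \<longleftrightarrow> buffer_ok s \<and> (flushing s = {} \<longrightarrow> num_GK G s < B)"

text \<open>At most \<open>B\<close> packets are buffered, so \<open>B\<close> GK-packets occupy the
  whole buffer: a flush phase starts with packets of the selected class only.\<close>

lemma start_flush_cases:
  assumes "buffer_ok s"
  obtains (same) "start_flush_if_Gfull P G s = s" "flushing s \<noteq> {} \<or> num_GK G s < B"
    | (start) "flushing s = {}" "num_GK G s = B" "GK_items G s = buffer s"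
      "start_flush_if_Gfull P G s = s\<lparr>flushing := ident ` buffer s\<rparr>" "card (buffer s) = B"
proof (cases "flushing s = {} \<and> num_GK G s = B")
  case True
  have "finite (buffer s)" "card (buffer s) \<le> B" using assms by (auto simp: buffer_ok_def)
  then have "GK_items G s = buffer s"
    using True card_seteq[OF _ GK_items_subset[of G s]] by (simp add: num_GK_eq)
  then show ?thesis using True start by (simp add: start_flush_if_Gfull_def num_GK_eq)
next
  case False
  have "num_GK G s \<le> card (buffer s)"
    unfolding num_GK_eq using assms by (auto simp: buffer_ok_def intro!: card_mono GK_items_subset)
  then have "num_GK G s \<le> B" using assms by (auto simp: buffer_ok_def)
  then have "flushing s \<noteq> {} \<or> num_GK G s < B" using False by auto
  moreover have "start_flush_if_Gfull P G s = s"
    using False by (auto simp: start_flush_if_Gfull_def)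
  ultimately show ?thesis using same by blast
qed

lemma start_flush_simps [simp]:
  "buffer (start_flush_if_Gfull P G s) = buffer s"
  "gained (start_flush_if_Gfull P G s) = gained s"
  "admitted (start_flush_if_Gfull P G s) = admitted s"
  by (simp_all add: start_flush_if_Gfull_def)

lemma state_ok_start_flush:
  assumes "buffer_ok s"
  shows "state_ok (start_flush_if_Gfull P G s)"
  using assms
proof (cases rule: start_flush_cases)
  case same
  then show ?thesis using assms by (auto simp: state_ok_def)
next
  case start
  then have "buffer s \<noteq> {}" using B_ge_2 by auto
  then show ?thesis using assms start by (auto simp: state_ok_def buffer_ok_def)
qed

lemma secured_start_flush:
  assumes "buffer_ok s"
  shows "secured G (start_flush_if_Gfull P G s) = secured G s"
  using assms
proof (cases rule: start_flush_cases)
  case same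
  then show ?thesis by simp
next
  case start
  then have "buffer s \<noteq> {}" using B_ge_2 by auto
  moreover have "flush_items (s\<lparr>flushing := ident ` buffer s\<rparr>) = buffer s"
    by (auto simp: flush_items_def)
  ultimately show ?thesis using start by (simp add: secured_def guaranteed_def)
qed

lemma flush_start:
  assumes "buffer_ok s" "start_flush_if_Gfull P G s \<noteq> s"
  defines "s' \<equiv> start_flush_if_Gfull P G s"
  shows "flushing s = {}" "flush_work s' \<le> B * b" "flush_secured s + B * c \<le> flush_secured s'"
proof -
  show fill: "flushing s = {}" using assms(1)
    by (cases rule: start_flush_cases) (use assms in auto)
  have *: "s' = s\<lparr>flushing := ident ` buffer s\<rparr>" "GK_items G s = buffer s" "card (buffer s) = B"
    using assms(1) by (cases rule: start_flush_cases; use assms in auto)+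
  have items: "flush_items s' = buffer s"
    by (auto simp: flush_items_def *)
  have GK: "pkt x \<in> G" if "x \<in> buffer s" for x
    using that *(2) by (auto simp: GK_items_def GK_def)
  have ok: "item_ok x" if "x \<in> buffer s" for x
    using that assms by (auto simp: buffer_ok_def)
  have "flush_work s' \<le> (\<Sum>x\<in>buffer s. b)"
    unfolding flush_work_def items
    by (rule sum_mono) (use GK work_G ok in \<open>force simp: item_ok_def\<close>)
  then show "flush_work s' \<le> B * b" by (simp add: *(3))
  have "(\<Sum>x\<in>buffer s. c) \<le> total_profit (buffer s)"
    unfolding total_profit_def by (rule sum_mono) (use GK profit_G in auto)
  then show "flush_secured s + B * c \<le> flush_secured s'"
    using fill items *(3) by (simp add: flush_secured_fill) (simp add: flush_secured_def *(1))
qed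

text \<open>The transmission step before its check for Gfull. The check closes several steps and is
  charged once and for all in \<open>potential_start_flush\<close>; \<open>process_only\<close> is
  split off for the same reason.\<close>

definition transmit_only :: "sa_state \<Rightarrow> sa_state" where
  "transmit_only s = (let D = finished (buffer s) in
     s\<lparr>buffer := buffer s - D, flushing := flushing s - ident ` D, gained := gained s + total_profit D\<rparr>)"

lemma transmit_eq: "transmit P G s = start_flush_if_Gfull P G (transmit_only s)"
  by (simp add: transmit_def transmit_only_def Let_def)

text \<open>The delicate case is the end of a flush phase, when \<open>guaranteed\<close> switches
  from flush packets to GK-packets. All remaining flush packets are then among the transmitted ones,
  so nothing is lost, and GK-packets that arrived during the flush only add to
  \<open>secured\<close>. \<open>flush_work\<close> is unchanged because transmitted packets have no
  work left.\<close>

lemma transmit_only_props: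
  assumes "buffer_ok s"
  defines "s' \<equiv> transmit_only s"
  shows "buffer_ok s'" "live s'" "admitted s' = admitted s" "buffer s' \<subseteq> buffer s"
    "buffer s' = {x \<in> buffer s. remaining x \<noteq> 0}"
    "secured G s \<le> secured G s'" "flush_secured s \<le> flush_secured s'"
    "flush_work s' = flush_work s"
proof -
  let ?D = "finished (buffer s)"
  have s': "buffer s' = buffer s - ?D" "flushing s' = flushing s - ident ` ?D"
    "gained s' = gained s + total_profit ?D" "admitted s' = admitted s"
    by (simp_all add: s'_def transmit_only_def Let_def)
  have fin: "finite (buffer s)" and inj: "inj_on ident (buffer s)"
    using assms by (auto simp: buffer_ok_def)
  have D: "?D \<subseteq> buffer s" by (auto simp: finished_def)
  have finD: "finite ?D" using D fin by (rule finite_subset)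
  have card: "card (buffer s - ?D) \<le> card (buffer s)" using fin by (intro card_mono) auto
  have notin: "ident x \<notin> ident ` ?D" if "x \<in> buffer s - ?D" for x
    using that D inj by (auto dest: inj_onD)
  have "flushing s - ident ` ?D \<subseteq> ident ` (buffer s - ?D)"
    using assms(1) by (simp add: buffer_ok_def) blast
  then show "buffer_ok s'"
    using assms(1) card by (simp add: buffer_ok_def s' inj_on_diff)
  show "live s'" by (auto simp: live_def s' finished_def)
  show "admitted s' = admitted s" "buffer s' \<subseteq> buffer s"
    "buffer s' = {x \<in> buffer s. remaining x \<noteq> 0}" by (auto simp: s' finished_def)
  have fl: "flush_items s - ?D = flush_items s'"
    using notin by (auto simp: flush_items_def s')
  have g: "guaranteed G s \<subseteq> ?D \<union> guaranteed G s'"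
  proof (cases "flushing s = {}")
    case True
    then show ?thesis by (auto simp: guaranteed_def GK_items_def s')
  next
    case False
    have "x \<in> guaranteed G s'" if "x \<in> guaranteed G s" "x \<notin> ?D" for x
    proof -
      have "x \<in> flush_items s'" using that False fl by (auto simp: guaranteed_def)
      moreover from this have "flushing s' \<noteq> {}" by (auto simp: flush_items_def)
      ultimately show ?thesis by (simp add: guaranteed_def)
    qed
    then show ?thesis by auto
  qed
  have fing: "finite (guaranteed G s')" "finite (flush_items s')"
    using fin by (auto simp: guaranteed_def GK_items_def flush_items_def s')
  have "total_profit (guaranteed G s) \<le> total_profit ?D + total_profit (guaranteed G s')"
    using total_profit_mono[OF _ g] total_profit_Un[OF finD fing(1)] finD fing(1)
    by (meson finite_UnI le_trans)
  then show "secured G s \<le> secured G s'" by (simp add: secured_def s')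
  have "flush_items s \<subseteq> ?D \<union> flush_items s'" using fl by auto
  then have "total_profit (flush_items s) \<le> total_profit ?D + total_profit (flush_items s')"
    using total_profit_mono[of "?D \<union> flush_items s'"] total_profit_Un[OF finD fing(2)] finD fing(2)
    by (meson finite_UnI le_trans)
  then show "flush_secured s \<le> flush_secured s'" by (simp add: flush_secured_def s')
  have finfl: "finite (flush_items s)" using fin by (simp add: flush_items_def)
  show "flush_work s' = flush_work s"
    unfolding flush_work_def fl[symmetric]
    by (rule sum.mono_neutral_left) (use finfl in \<open>auto simp: flush_items_def finished_def\<close>)
qed

section \<open>A single arrival\<close>

lemma buffer_ok_replace:
  assumes "buffer_ok s" "R \<subseteq> buffer s" "R \<inter> flush_items s = {}"
    and x: "ident x \<notin> ident ` buffer s" "item_ok x" and card: "card (buffer s - R) < B"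
    and s': "buffer s' = insert x (buffer s - R)" "flushing s' = flushing s"
  shows "buffer_ok s'" "flush_items s' = flush_items s"
proof -
  have fin: "finite (buffer s)" and inj: "inj_on ident (buffer s)"
    and fl: "flushing s \<subseteq> ident ` buffer s"
    using assms by (auto simp: buffer_ok_def)
  have "card (buffer s') \<le> Suc (card (buffer s - R))"
    unfolding s' by (rule card_insert_le_m1[THEN le_trans]) auto
  then have "card (buffer s') \<le> B" using card by linarith
  moreover have "inj_on ident (buffer s')"
    unfolding s' using inj x by (auto intro: inj_on_diff)
  moreover have "flushing s \<subseteq> ident ` (buffer s - R)"
  proof
    fix i assume i: "i \<in> flushing s"
    then obtain y where y: "y \<in> buffer s" "ident y = i" using fl by auto
    then have "y \<notin> R" using i assms(3) by (auto simp: flush_items_def)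
    then show "i \<in> ident ` (buffer s - R)" using y by auto
  qed
  ultimately show "buffer_ok s'"
    using assms(1) x fin by (auto simp: buffer_ok_def s')
  show "flush_items s' = flush_items s"
    using x fl assms(3) by (auto simp: flush_items_def s')
qed

lemma flush_arrival_props:
  assumes "buffer_ok s" "flushing s \<noteq> {}" "ident x \<notin> ident ` buffer s" "item_ok x"
  defines "s' \<equiv> flush_arrival P G x s"
  shows "buffer_ok s'" "flushing s' = flushing s" "gained s' = gained s"
    "flush_items s' = flush_items s" "buffer s' \<subseteq> insert x (buffer s)"
proof -
  define U where "U = {y \<in> buffer s. ident y \<notin> flushing s}"
  define l where "l = lowest P G s U"
  have fin: "finite (buffer s)" and inj: "inj_on ident (buffer s)"
    using assms by (auto simp: buffer_ok_def)
  have "s' = s \<or> card (buffer s) < B \<and> s' = accept x s \<or>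
    U \<noteq> {} \<and> s' = accept x (s\<lparr>buffer := buffer s - {l}\<rparr>)"
    unfolding s'_def flush_arrival_def Let_def U_def[symmetric] l_def full_def by simp
  then consider "s' = s" | "card (buffer s) < B" "s' = accept x s"
    | "U \<noteq> {}" "s' = accept x (s\<lparr>buffer := buffer s - {l}\<rparr>)" by blast
  then have "buffer_ok s' \<and> flushing s' = flushing s \<and> gained s' = gained s \<and>
    flush_items s' = flush_items s \<and> buffer s' \<subseteq> insert x (buffer s)"
  proof cases
    case 1
    then show ?thesis using assms(1) by auto
  next
    case 2
    then show ?thesis
      using buffer_ok_replace[OF assms(1), of "{}" x s'] assms(3,4) by (auto simp: accept_def)
  next
    case 3
    have "finite U" "inj_on ident U" using fin inj by (auto simp: U_def inj_on_def)
    then have "l \<in> U" unfolding l_def using lowest_props(1)[OF valid _ 3(1)] by simp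
    then have l: "l \<in> buffer s" "{l} \<inter> flush_items s = {}"
      by (auto simp: U_def flush_items_def)
    then have "card (buffer s - {l}) < card (buffer s)"
      using card_Diff1_less[OF fin] by blast
    then have "card (buffer s - {l}) < B"
      using assms(1) by (auto simp: buffer_ok_def)
    then show ?thesis
      using buffer_ok_replace[OF assms(1), of "{l}" x s'] l assms(3,4) 3(2)
      by (auto simp: accept_def)
  qed
  then show "buffer_ok s'" "flushing s' = flushing s" "gained s' = gained s"
    "flush_items s' = flush_items s" "buffer s' \<subseteq> insert x (buffer s)" by auto
qed

lemma make_room_props:
  assumes "buffer_ok s" "num_GK G s + (if admitted s = None then 0 else 1) < B"
  obtains R where "make_room P G s = s\<lparr>buffer := buffer s - R\<rparr>" "R \<subseteq> buffer s"
    "\<And>y. y \<in> R \<Longrightarrow> \<not> GK G y \<and> admitted s \<noteq> Some (ident y)" "card (buffer s - R) < B"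
proof (cases "full P s")
  case False
  then show ?thesis using that[of "{}"] by (simp add: make_room_def full_def)
next
  case True
  have fin: "finite (buffer s)" and inj: "inj_on ident (buffer s)" and card: "card (buffer s) = B"
    using assms(1) True by (auto simp: buffer_ok_def full_def)
  let ?A = "{y \<in> buffer s. admitted s = Some (ident y)}"
  have "card ?A \<le> (if admitted s = None then 0 else 1)"
  proof (cases "admitted s")
    case (Some i)
    have "card ?A \<le> Suc 0"
      using fin Some inj by (subst card_le_Suc0_iff_eq) (auto dest: inj_onD)
    then show ?thesis using Some by simp
  qed simp
  moreover have "card (GK_items G s \<union> ?A) \<le> num_GK G s + card ?A"
    unfolding num_GK_eq by (rule card_Un_le)
  ultimately have "card (GK_items G s \<union> ?A) < card (buffer s)"
    using assms(2) card by linarith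
  moreover have "finite (GK_items G s \<union> ?A)" using fin by (simp add: GK_items_def)
  ultimately have "\<not> buffer s \<subseteq> GK_items G s \<union> ?A"
    using card_mono[of "GK_items G s \<union> ?A" "buffer s"] by linarith
  then obtain y where y: "y \<in> buffer s" "\<not> GK G y" "admitted s \<noteq> Some (ident y)"
    by (auto simp: GK_items_def)
  note l = lowest_not_GK[OF valid fin inj y]
  have "card (buffer s - {lowest P G s (buffer s)}) < B"
    using card_Diff1_less[OF fin l(1)] card by simp
  then show ?thesis
    using l True that[of "{lowest P G s (buffer s)}"] by (simp add: make_room_def)
qed

definition admission_inv :: "bool \<Rightarrow> nat \<Rightarrow> sa_state \<Rightarrow> bool" where
  "admission_inv adm u s \<longleftrightarrow> admitted_unknown s \<and> (u = 0 \<or> \<not> adm \<longrightarrow> admitted s = None) \<and>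
     (0 < u \<and> adm \<longrightarrow> admitted s \<noteq> None)"

lemma fill_replace:
  assumes ok: "buffer_ok s" "live s" and fill: "flushing s = {}"
    and x: "ident x \<notin> ident ` buffer s" "item_ok x" "1 \<le> remaining x"
    and R: "R \<subseteq> buffer s" "\<And>y. y \<in> R \<Longrightarrow> \<not> GK G y" "card (buffer s - R) < B"
    and s': "buffer s' = insert x (buffer s - R)" "flushing s' = {}"
  shows "buffer_ok s'" "live s'" "GK_items G s' = (if GK G x then {x} else {}) \<union> GK_items G s"
  using buffer_ok_replace[OF ok(1) R(1) _ x(1,2) R(3) s'(1)] fill s' ok(2) R(2) x(3)
  by (auto simp: live_def GK_items_def)

lemma admitted_not_GK:
  assumes "buffer_ok s" "admitted_unknown s" "y \<in> buffer s" "admitted s = Some (ident y)"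
  shows "\<not> GK G y" "\<not> known y"
proof -
  obtain z where "z \<in> buffer s" "ident z = ident y" "\<not> known z"
    using assms(2,4) by (auto simp: admitted_unknown_def)
  then show "\<not> known y" using assms(1,3) by (auto simp: buffer_ok_def dest: inj_onD)
  then show "\<not> GK G y" by (simp add: GK_def)
qed

text \<open>Stated for the state before the check for Gfull, since starting a flush phase is accounted for
  separately.\<close>

definition fill_successor :: "bool \<Rightarrow> nat \<Rightarrow> item \<Rightarrow> sa_state \<Rightarrow> sa_state \<Rightarrow> bool" where
  "fill_successor adm u x s s0 \<longleftrightarrow> buffer_ok s0 \<and> live s0 \<and> flushing s0 = {} \<and> gained s0 = gained s \<and>
     GK_items G s0 = (if GK G x then {x} else {}) \<union> GK_items G s \<and>
     buffer s0 \<subseteq> insert x (buffer s) \<and>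
     (num_GK G s + (if GK G x then 1 else 0) < B \<longrightarrow> admission_inv adm (if known x then u else Suc u) s0)"

lemma start_flush_below:
  assumes "num_GK G s < B" shows "start_flush_if_Gfull P G s = s"
  using assms by (simp add: start_flush_if_Gfull_def)

lemma fill_arrival_GK:
  assumes ok: "state_ok s" "live s" and fill: "flushing s = {}" and adm: "admission_inv adm u s"
    and x: "ident x \<notin> ident ` buffer s" "item_ok x" "1 \<le> remaining x" and GK: "GK G x"
  defines "s1 \<equiv> if num_GK G s = B - 1 then drop_admitted s else s"
  shows "fill_successor adm u x s (accept x (make_room P G s1))"
    and "num_GK G s + 1 < B \<Longrightarrow> admitted (accept x (make_room P G s1)) = admitted s"
proof -
  have bok: "buffer_ok s" and num: "num_GK G s < B" using ok fill by (auto simp: state_ok_def)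
  have fin: "finite (buffer s)" using bok by (auto simp: buffer_ok_def)
  define A where "A = (if num_GK G s = B - 1 then {y \<in> buffer s. admitted s = Some (ident y)} else {})"
  have A: "A \<subseteq> buffer s" "\<And>y. y \<in> A \<Longrightarrow> \<not> GK G y"
    using admitted_not_GK[OF bok] adm by (auto simp: A_def admission_inv_def split: if_splits)
  have s1: "buffer s1 = buffer s - A" "flushing s1 = {}" "gained s1 = gained s"
    using fill by (auto simp: s1_def A_def drop_admitted_def)
  have s1_adm: "admitted s1 = (if num_GK G s = B - 1 then None else admitted s)"
    by (auto simp: s1_def drop_admitted_def)
  have GK1: "GK_items G s1 = GK_items G s" using A by (auto simp: GK_items_def s1)
  have "card (buffer s1) \<le> card (buffer s)" unfolding s1 using fin by (intro card_mono) auto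
  then have bok1: "buffer_ok s1"
    using bok s1 by (auto simp: buffer_ok_def inj_on_diff)
  have "num_GK G s1 + (if admitted s1 = None then 0 else 1) < B"
    using num GK1 s1_adm by (auto simp: num_GK_eq)
  from make_room_props[OF bok1 this] obtain R where
    R: "make_room P G s1 = s1\<lparr>buffer := buffer s1 - R\<rparr>" "R \<subseteq> buffer s1"
      "\<And>y. y \<in> R \<Longrightarrow> \<not> GK G y \<and> admitted s1 \<noteq> Some (ident y)" "card (buffer s1 - R) < B"
    by metis
  let ?s2 = "accept x (make_room P G s1)"
  have s2: "buffer ?s2 = insert x (buffer s - (A \<union> R))" "flushing ?s2 = {}"
    "gained ?s2 = gained s" "admitted ?s2 = admitted s1"
    using s1 by (auto simp: R(1) accept_def)
  have AR: "A \<union> R \<subseteq> buffer s" "card (buffer s - (A \<union> R)) < B"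
    using A R(2,4) s1 by (auto simp: Diff_Un Diff_Diff_Int set_diff_eq conj_assoc)
  have nGK: "\<not> GK G y" if "y \<in> A \<union> R" for y using that A R(3) by auto
  note r = fill_replace[OF bok ok(2) fill x AR(1) nGK AR(2) s2(1,2)]
  have inv: "admission_inv adm (if known x then u else Suc u) ?s2" if "num_GK G s + 1 < B"
  proof -
    have "num_GK G s \<noteq> B - 1" using that by auto
    then have a: "admitted s1 = admitted s" "A = {}" using s1_adm by (auto simp: A_def)
    have "known x" using GK by (simp add: GK_def)
    moreover have "admitted_unknown ?s2"
      using adm R(3) a unfolding admission_inv_def admitted_unknown_def s2 by fastforce
    ultimately show ?thesis using adm a by (auto simp: admission_inv_def s2)
  qed
  show "fill_successor adm u x s ?s2"
    unfolding fill_successor_def using r s2 inv GK by auto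
  show "admitted ?s2 = admitted s" if "num_GK G s + 1 < B"
    using that s2 s1_adm by auto
qed

text \<open>The last premise excludes just the first unknown packet of an admittance cycle: leaving
  it unmarked would violate \<open>admission_inv\<close>.\<close>

lemma accept_if_space_props:
  assumes ok: "state_ok s" "live s" and fill: "flushing s = {}" and adm: "admission_inv adm u s"
    and x: "ident x \<notin> ident ` buffer s" "item_ok x" "1 \<le> remaining x" and nGK: "\<not> GK G x"
    and u: "known x \<or> \<not> adm \<or> 0 < u"
  shows "fill_successor adm u x s (accept_if_space P x s)"
proof -
  have bok: "buffer_ok s" using ok by (auto simp: state_ok_def)
  let ?s = "accept_if_space P x s"
  have "buffer_ok ?s \<and> live ?s \<and> GK_items G ?s = GK_items G s"
  proof (cases "full P s")
    case True
    then show ?thesis using bok ok by (simp add: accept_if_space_def)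
  next
    case False
    then show ?thesis
      using fill_replace[OF bok ok(2) fill x, of "{}" ?s] nGK fill
      by (simp add: accept_if_space_def accept_def full_def)
  qed
  moreover have "admission_inv adm (if known x then u else Suc u) ?s"
    using adm u unfolding admission_inv_def admitted_unknown_def
    by (auto simp: accept_if_space_def accept_def)
  ultimately show ?thesis
    using nGK fill by (auto simp: fill_successor_def accept_if_space_def accept_def)
qed

lemma admit_first_props:
  assumes ok: "state_ok s" "live s" and fill: "flushing s = {}" and adm: "admission_inv True 0 s"
    and x: "ident x \<notin> ident ` buffer s" "item_ok x" "1 \<le> remaining x" and unk: "\<not> known x"
  shows "fill_successor True 0 x s ((accept x (make_room P G s))\<lparr>admitted := Some (ident x)\<rparr>)"
proof -
  have bok: "buffer_ok s" and num: "num_GK G s < B" using ok fill by (auto simp: state_ok_def)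
  have nGK: "\<not> GK G x" using unk by (simp add: GK_def)
  have "num_GK G s + (if admitted s = None then 0 else 1) < B"
    using num adm by (simp add: admission_inv_def)
  from make_room_props[OF bok this] obtain R where
    R: "make_room P G s = s\<lparr>buffer := buffer s - R\<rparr>" "R \<subseteq> buffer s"
      "\<And>y. y \<in> R \<Longrightarrow> \<not> GK G y \<and> admitted s \<noteq> Some (ident y)" "card (buffer s - R) < B"
    by metis
  let ?s = "(accept x (make_room P G s))\<lparr>admitted := Some (ident x)\<rparr>"
  have s': "buffer ?s = insert x (buffer s - R)" "flushing ?s = {}" "gained ?s = gained s"
    using fill by (auto simp: R(1) accept_def)
  have "\<not> GK G y" if "y \<in> R" for y using that R(3) by auto
  note r = fill_replace[OF bok ok(2) fill x R(2) this R(4) s'(1,2)]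
  have "admission_inv True (Suc 0) ?s"
    using unk by (auto simp: admission_inv_def admitted_unknown_def accept_def)
  then show ?thesis using r s' nGK unk by (auto simp: fill_successor_def)
qed

lemma admit_replace_props:
  assumes ok: "state_ok s" "live s" and fill: "flushing s = {}" and adm: "admission_inv True u s"
    and u: "0 < u"
    and x: "ident x \<notin> ident ` buffer s" "item_ok x" "1 \<le> remaining x" and unk: "\<not> known x"
  shows "fill_successor True u x s ((accept x (drop_admitted s))\<lparr>admitted := Some (ident x)\<rparr>)"
proof -
  have bok: "buffer_ok s" and num: "num_GK G s < B" using ok fill by (auto simp: state_ok_def)
  have fin: "finite (buffer s)" using bok by (auto simp: buffer_ok_def)
  have nGK: "\<not> GK G x" using unk by (simp add: GK_def)
  let ?R = "{y \<in> buffer s. admitted s = Some (ident y)}"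
  have au: "admitted_unknown s" using adm by (simp add: admission_inv_def)
  obtain i where "admitted s = Some i" using adm u by (auto simp: admission_inv_def)
  then have "?R \<noteq> {}" using au by (auto simp: admitted_unknown_def)
  \<comment> \<open>The invariant supplies a buffered packet with the mark; its removal frees the
    slot for \<open>x\<close> even in a full buffer.\<close>
  then have "card (buffer s - ?R) < card (buffer s)"
    using fin by (intro psubset_card_mono) auto
  then have card: "card (buffer s - ?R) < B" using bok by (auto simp: buffer_ok_def)
  let ?s = "(accept x (drop_admitted s))\<lparr>admitted := Some (ident x)\<rparr>"
  have s': "buffer ?s = insert x (buffer s - ?R)" "flushing ?s = {}" "gained ?s = gained s"
    using fill by (auto simp: accept_def drop_admitted_def)
  have "\<not> GK G y" if "y \<in> ?R" for y using that admitted_not_GK[OF bok au] by auto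
  note r = fill_replace[OF bok ok(2) fill x _ this card s'(1,2)]
  have "admission_inv True (Suc u) ?s"
    using unk by (auto simp: admission_inv_def admitted_unknown_def accept_def)
  then show ?thesis using r s' nGK unk by (auto simp: fill_successor_def)
qed

lemma fill_arrival_support:
  assumes ok: "state_ok s" "live s" and fill: "flushing s = {}" and adm: "admission_inv adm u s"
    and x: "ident x \<notin> ident ` buffer s" "item_ok x" "1 \<le> remaining x"
    and s': "s' \<in> set_pmf (fill_arrival P G adm (if known x then u else Suc u) x s)"
  shows "\<exists>s0. s' = start_flush_if_Gfull P G s0 \<and> fill_successor adm u x s s0"
proof (cases "GK G x")
  case True
  then show ?thesis
    using fill_arrival_GK(1)[OF ok fill adm x True] s' by (auto simp: fill_arrival_def)
next
  case False
  have num: "num_GK G s < B" using ok fill by (auto simp: state_ok_def)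
  have "fill_successor adm u x s s'"
  proof (cases "\<not> known x \<and> adm")
    case T: True
    then show ?thesis
    proof (cases "u = 0")
      case True
      then show ?thesis
        using admit_first_props[OF ok fill _ x] T s' adm False by (auto simp: fill_arrival_def)
    next
      case u: False
      then show ?thesis
        using admit_replace_props[OF ok fill _ _ x] accept_if_space_props[OF ok fill _ x False]
          T s' adm False
        by (auto simp: fill_arrival_def split: if_splits)
    qed
  next
    case nT: False
    then show ?thesis
      using accept_if_space_props[OF ok fill adm x False] s' False by (auto simp: fill_arrival_def)
  qed
  \<comment> \<open>Only the GK branch performs the check for Gfull. In the other branches the
    number of GK-packets stays below \<open>B\<close>, so the check is the identity and
    \<open>s'\<close> itself serves as \<open>s0\<close>.\<close>
  moreover from this have "num_GK G s' = num_GK G s"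
    using False by (simp add: fill_successor_def num_GK_eq)
  ultimately show ?thesis using start_flush_below[of s'] num by metis
qed

end

section \<open>Processing and the admission of unknown packets\<close>

lemma process_item_simps [simp]:
  "ident (process_item x) = ident x" "pkt (process_item x) = pkt x"
  "remaining (process_item x) = remaining x - 1"
  by (simp_all add: process_item_def)

section \<open>Expectations over finitely supported distributions\<close>

lemma expectation_bind_finite:
  fixes h :: "'b \<Rightarrow> real"
  assumes "finite (set_pmf q)" "\<And>x. x \<in> set_pmf q \<Longrightarrow> finite (set_pmf (f x))"
  shows "measure_pmf.expectation (bind_pmf q f) h =
    measure_pmf.expectation q (\<lambda>x. measure_pmf.expectation (f x) h)"
  using assms by (simp add: pmf_expectation_bind[where A="set_pmf q"] integral_measure_pmf[where A="set_pmf q"])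

lemma expectation_mono_finite:
  fixes f g :: "'b \<Rightarrow> real"
  assumes "finite (set_pmf q)" "\<And>x. x \<in> set_pmf q \<Longrightarrow> f x \<le> g x"
  shows "measure_pmf.expectation q f \<le> measure_pmf.expectation q g"
  using assms by (intro integral_mono_AE integrable_measure_pmf_finite) (auto simp: AE_measure_pmf_iff)

lemma finite_sa_arrivals: "finite (set_pmf (sa_arrivals P G adm u xs s))"
proof (induction xs arbitrary: u s)
  case (Cons x xs)
  have "finite (set_pmf (fill_arrival P G adm m x s))" for m
    by (auto simp: fill_arrival_def)
  then show ?case using Cons by (auto simp: Let_def)
qed simp

lemma finite_sa_cycle: "finite (set_pmf (sa_cycle P G xs s))"
  by (auto simp: sa_cycle_def finite_sa_arrivals)

lemma finite_sa_run: "finite (set_pmf (sa_run P G arr n))"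
  by (induction n) (auto simp: finite_sa_cycle)

text \<open>One reservoir step with \<open>m\<close> unknown packets seen: \<open>a\<close> is the
  value of the new packet, which takes the mark with probability 1/m, and \<open>c\<close> that of
  the previous holder, which ends with weight m - 1; \<open>R\<close> stands for the packets still
  to come.\<close>

lemma weighted_average:
  fixes m :: real
  assumes "m \<noteq> 0"
  shows "(m * a + R) * (1 / m) + (m * c + R) * (1 - 1 / m) = (m - 1) * c + (a + R)"
  using assms by (simp add: field_simps)

context selected_class
begin

definition process_only :: "sa_state \<Rightarrow> sa_state" where
  "process_only s = (let S = (if flushing s = {} then buffer s else flush_items s);
     h = highest P G s S in
     s\<lparr>buffer := (if S = {} then buffer s else insert (process_item h) (buffer s - {h})),
       admitted := None\<rparr>)"

lemma sa_process_eq: "sa_process P G s = start_flush_if_Gfull P G (process_only s)"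
  unfolding sa_process_def process_only_def flush_items_def Let_def by (rule refl)

lemma buffer_ok_process:
  assumes "buffer_ok s" "h \<in> buffer s"
    and s': "buffer s' = insert (process_item h) (buffer s - {h})" "flushing s' = flushing s"
  shows "buffer_ok s'"
proof -
  have fin: "finite (buffer s)" and inj: "inj_on ident (buffer s)"
    using assms by (auto simp: buffer_ok_def)
  have "card (buffer s') \<le> Suc (card (buffer s - {h}))"
    unfolding s' using fin by (simp add: card_insert_if)
  also have "\<dots> = card (buffer s)" using fin assms(2) by (rule card_Suc_Diff1)
  finally have "card (buffer s') \<le> card (buffer s)" .
  moreover have "inj_on ident (buffer s')"
    unfolding s' using inj assms(2) by (auto simp: inj_on_def)
  moreover have "ident ` buffer s' = ident ` buffer s"
    unfolding s' using assms(2) by (auto simp: image_iff)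
  moreover have "item_ok (process_item h)"
    using assms by (auto simp: buffer_ok_def item_ok_def)
  ultimately show ?thesis
    using assms(1) by (auto simp: buffer_ok_def s')
qed

lemma known_process: "item_ok x \<Longrightarrow> 1 \<le> remaining x \<Longrightarrow> known (process_item x)"
  by (auto simp: known_def item_ok_def)

lemma total_profit_insert:
  "finite A \<Longrightarrow> x \<notin> A \<Longrightarrow> total_profit (insert x A) = profit (pkt x) + total_profit A"
  by (simp add: total_profit_def)

lemma total_profit_process:
  assumes "finite A" "inj_on ident A" "h \<in> A"
  shows "total_profit (insert (process_item h) (A - {h})) = total_profit A"
proof -
  have "process_item h \<notin> A - {h}"
    using assms by (metis DiffD1 DiffD2 inj_onD process_item_simps(1) singletonI)
  moreover have "total_profit A = profit (pkt h) + total_profit (A - {h})"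
    unfolding total_profit_def using assms by (simp add: sum.remove)
  ultimately show ?thesis using assms(1) by (simp add: total_profit_insert)
qed

text \<open>Processing is never idle here: \<open>flush_items\<close> is nonempty, and by
  \<open>live\<close> the chosen packet has work left. The drop of \<open>flush_work\<close> makes
  the length of the flush phase deterministic; the drop of the total remaining work serves to show
  that the buffer empties.\<close>

lemma process_flush:
  assumes "buffer_ok s" "live s" "flushing s \<noteq> {}"
  shows "buffer_ok (process_only s)" "flushing (process_only s) = flushing s"
    "flush_secured (process_only s) = flush_secured s"
    "flush_work s = Suc (flush_work (process_only s))"
    "ident ` buffer (process_only s) \<subseteq> ident ` buffer s"
    "sum remaining (buffer s) = Suc (sum remaining (buffer (process_only s)))"
proof -
  let ?s = "process_only s"
  have fin: "finite (buffer s)" and inj: "inj_on ident (buffer s)"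
    and fl: "flushing s \<subseteq> ident ` buffer s"
    using assms by (auto simp: buffer_ok_def)
  define h where "h = highest P G s (flush_items s)"
  have ne: "flush_items s \<noteq> {}" using assms(3) fl by (fastforce simp: flush_items_def)
  have finfl: "finite (flush_items s)" using fin by (simp add: flush_items_def)
  have injfl: "inj_on ident (flush_items s)"
    using inj by (rule inj_on_subset) (rule flush_items_subset)
  have h: "h \<in> flush_items s" unfolding h_def by (rule highest_props(1)[OF valid finfl ne injfl])
  then have hb: "h \<in> buffer s" using flush_items_subset by auto
  have s': "buffer ?s = insert (process_item h) (buffer s - {h})"
    "flushing ?s = flushing s" "gained ?s = gained s"
    using assms(3) ne by (auto simp: process_only_def Let_def h_def)
  show "buffer_ok ?s" by (rule buffer_ok_process[OF assms(1) hb s'(1,2)])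
  show "flushing ?s = flushing s" by fact
  have fl': "flush_items ?s = insert (process_item h) (flush_items s - {h})"
    using h by (auto simp: flush_items_def s')
  show "flush_secured ?s = flush_secured s"
    unfolding flush_secured_def fl' s' by (simp add: total_profit_process[OF finfl injfl h])
  have r1: "1 \<le> remaining h" using assms(2) hb by (simp add: live_def)
  have sum: "sum remaining A = Suc (sum remaining (insert (process_item h) (A - {h})))"
    if "A \<subseteq> buffer s" "h \<in> A" for A
  proof -
    have finA: "finite A" using that fin finite_subset by auto
    have "process_item h \<notin> A - {h}"
    proof
      assume a: "process_item h \<in> A - {h}"
      then have "process_item h = h"
        using inj_onD[OF inj, of "process_item h" h] that by auto
      then show False using a by auto
    qed
    then have "sum remaining (insert (process_item h) (A - {h})) =
        remaining h - 1 + sum remaining (A - {h})"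
      using finA by simp
    moreover have "sum remaining A = remaining h + sum remaining (A - {h})"
      using finA that by (simp add: sum.remove)
    ultimately show ?thesis using r1 by simp
  qed
  show "flush_work s = Suc (flush_work ?s)"
    unfolding flush_work_def fl' using sum[OF flush_items_subset h] .
  show "sum remaining (buffer s) = Suc (sum remaining (buffer ?s))"
    unfolding s' using sum[OF subset_refl hb] .
  show "ident ` buffer ?s \<subseteq> ident ` buffer s" using hb by (auto simp: s')
qed

text \<open>What processing the admitted packet adds to the secured profit.\<close>

definition admission_value :: "ident option \<Rightarrow> nat" where
  "admission_value a = (case a of None \<Rightarrow> 0 | Some i \<Rightarrow> if pk i \<in> G then profit (pk i) else 0)"

lemma process_fill:
  assumes "buffer_ok s" "live s" "flushing s = {}" "admitted_unknown s"
  shows "buffer_ok (process_only s)" "flushing (process_only s) = {}"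
    "gained (process_only s) = gained s"
    "secured G s + admission_value (admitted s) \<le> secured G (process_only s)"
    "ident ` buffer (process_only s) \<subseteq> ident ` buffer s"
    "buffer s \<noteq> {} \<Longrightarrow> sum remaining (buffer s) = Suc (sum remaining (buffer (process_only s)))"
    "buffer s = {} \<Longrightarrow> buffer (process_only s) = {}"
proof -
  let ?s = "process_only s"
  have fin: "finite (buffer s)" and inj: "inj_on ident (buffer s)"
    using assms by (auto simp: buffer_ok_def)
  have fl: "flushing ?s = {}" and ga: "gained ?s = gained s"
    using assms(3) by (auto simp: process_only_def Let_def)
  show "flushing ?s = {}" "gained ?s = gained s" by fact+
  have all: "buffer_ok ?s \<and> ident ` buffer ?s \<subseteq> ident ` buffer s \<and>
    secured G s + admission_value (admitted s) \<le> secured G ?s \<and>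
    (buffer s \<noteq> {} \<longrightarrow> sum remaining (buffer s) = Suc (sum remaining (buffer ?s))) \<and>
    (buffer s = {} \<longrightarrow> buffer ?s = {})"
  proof (cases "buffer s = {}")
    case True
    then have "admitted s = None"
      using assms(4) by (cases "admitted s") (auto simp: admitted_unknown_def)
    moreover have b: "buffer ?s = {}" using True by (simp add: process_only_def assms(3))
    ultimately show ?thesis
      using True assms(1,3) fl ga
      by (simp add: secured_fill GK_items_def admission_value_def buffer_ok_def)
  next
    case False
    define h where "h = highest P G s (buffer s)"
    have h: "h \<in> buffer s" unfolding h_def by (rule highest_props(1)[OF valid fin False inj])
    have s': "buffer ?s = insert (process_item h) (buffer s - {h})"
      using assms(3) False by (auto simp: process_only_def Let_def h_def)
    have new: "process_item h \<notin> buffer s - {h}"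
    proof
      assume a: "process_item h \<in> buffer s - {h}"
      then have "process_item h = h"
        using inj_onD[OF inj, of "process_item h" h] h by auto
      then show False using a by auto
    qed
    have ok: "item_ok h" and r1: "1 \<le> remaining h"
      using assms(1,2) h by (auto simp: buffer_ok_def live_def)
    have kn: "known (process_item h)" by (rule known_process[OF ok r1])
    have "buffer_ok ?s" by (rule buffer_ok_process[OF assms(1) h s']) (simp add: fl assms(3))
    moreover have "ident ` buffer ?s \<subseteq> ident ` buffer s" using h by (auto simp: s')
    moreover have "sum remaining (buffer s) = Suc (sum remaining (buffer ?s))"
    proof -
      have "sum remaining (buffer ?s) = remaining h - 1 + sum remaining (buffer s - {h})"
        unfolding s' using fin new by simp
      moreover have "sum remaining (buffer s) = remaining h + sum remaining (buffer s - {h})"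
        using fin h by (simp add: sum.remove)
      ultimately show ?thesis using r1 by simp
    qed
    moreover have "secured G s + admission_value (admitted s) \<le> secured G ?s"
    proof -
      have finGK: "finite (GK_items G s)" using fin by (simp add: GK_items_def)
      have injGK: "inj_on ident (GK_items G s)"
        using inj by (rule inj_on_subset) (rule GK_items_subset)
      have "total_profit (GK_items G s) + admission_value (admitted s) \<le> total_profit (GK_items G ?s)"
      proof (cases "GK G h")
        case True
        have "admission_value (admitted s) = 0"
        proof (cases "admitted s")
          case (Some i)
          then obtain y where y: "y \<in> buffer s" "ident y = i" "\<not> known y"
            using assms(4) by (auto simp: admitted_unknown_def)
          then have "h = y"
            unfolding h_def using Some by (intro highest_admitted[OF valid fin inj]) auto
          then show ?thesis using y True by (simp add: GK_def)
        qed (simp add: admission_value_def)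
        moreover have "GK_items G ?s = insert (process_item h) (GK_items G s - {h})"
          using True kn by (auto simp: GK_items_def s' GK_def)
        moreover have "h \<in> GK_items G s" using True h by (simp add: GK_items_def)
        ultimately show ?thesis by (simp add: total_profit_process[OF finGK injGK])
      next
        case False
        have eq: "GK_items G ?s = (if pkt h \<in> G then {process_item h} else {}) \<union> GK_items G s"
          using False kn h by (auto simp: GK_items_def s' GK_def)
        have notin: "process_item h \<notin> GK_items G s"
          using new False by (auto simp: GK_items_def)
        have "total_profit (GK_items G ?s) =
          (if pkt h \<in> G then profit (pkt h) else 0) + total_profit (GK_items G s)"
          unfolding eq using finGK notin by (simp add: total_profit_insert)
        moreover have "admission_value (admitted s) \<le> (if pkt h \<in> G then profit (pkt h) else 0)"
        proof (cases "admitted s")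
          case (Some i)
          then obtain y where y: "y \<in> buffer s" "ident y = i" "\<not> known y"
            using assms(4) by (auto simp: admitted_unknown_def)
          then have "h = y"
            unfolding h_def using Some by (intro highest_admitted[OF valid fin inj]) auto
          then show ?thesis using y ok Some by (simp add: admission_value_def item_ok_def)
        qed (simp add: admission_value_def)
        ultimately show ?thesis by simp
      qed
      then show ?thesis using assms(3) fl ga by (simp add: secured_fill)
    qed
    ultimately show ?thesis using False by blast
  qed
  show "buffer_ok ?s" "ident ` buffer ?s \<subseteq> ident ` buffer s"
    "secured G s + admission_value (admitted s) \<le> secured G ?s"
    "buffer s \<noteq> {} \<Longrightarrow> sum remaining (buffer s) = Suc (sum remaining (buffer ?s))"
    "buffer s = {} \<Longrightarrow> buffer ?s = {}" using all by blast+
qed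

lemma admitted_process [simp]: "admitted (process_only s) = None"
  by (simp add: process_only_def Let_def)

definition fresh_items :: "item list \<Rightarrow> sa_state \<Rightarrow> bool" where
  "fresh_items xs s \<longleftrightarrow> distinct (map ident xs) \<and>
     (\<forall>x\<in>set xs. ident x \<notin> ident ` buffer s \<and> item_ok x \<and> remaining x = work (pkt x))"

lemma fresh_items_Cons:
  assumes "fresh_items (x # xs) s"
  shows "ident x \<notin> ident ` buffer s" "item_ok x" "1 \<le> remaining x"
    "buffer s' \<subseteq> insert x (buffer s) \<Longrightarrow> fresh_items xs s'"
proof -
  show "ident x \<notin> ident ` buffer s" "item_ok x" "1 \<le> remaining x"
    using assms by (auto simp: fresh_items_def item_ok_def)
  assume "buffer s' \<subseteq> insert x (buffer s)"
  then have "ident ` buffer s' \<subseteq> insert (ident x) (ident ` buffer s)" by blast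
  moreover have "ident y \<noteq> ident x" if "y \<in> set xs" for y
  proof -
    have "ident x \<notin> ident ` set xs" using assms by (simp add: fresh_items_def)
    with imageI[OF that, of ident] show ?thesis by metis
  qed
  moreover have "ident y \<notin> ident ` buffer s" if "y \<in> set xs" for y
    using assms that by (simp add: fresh_items_def)
  ultimately have "ident y \<notin> ident ` buffer s'" if "y \<in> set xs" for y
    using that by blast
  then show "fresh_items xs s'" using assms unfolding fresh_items_def by simp
qed

lemma fill_step:
  assumes s: "state_ok s" "flushing s = {}" and fr: "ident x \<notin> ident ` buffer s"
    and s0: "fill_successor adm u x s s0" "s' = start_flush_if_Gfull P G s0"
  shows "state_ok s'" "live s'" "buffer s' \<subseteq> insert x (buffer s)"
    "num_GK G s + (if GK G x then 1 else 0) < B \<Longrightarrow>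
       s' = s0 \<and> num_GK G s' = num_GK G s + (if GK G x then 1 else 0) \<and>
       flushing s' = {} \<and> admission_inv adm (if known x then u else Suc u) s'"
    "\<not> num_GK G s + (if GK G x then 1 else 0) < B \<Longrightarrow> flushing s' \<noteq> {}"
    "secured G s0 = secured G s + (if GK G x then profit (pkt x) else 0)"
    "flush_secured s0 = flush_secured s" "flush_work s0 = 0" "buffer_ok s0"
proof -
  have fin: "finite (GK_items G s)" using s by (auto simp: state_ok_def buffer_ok_def GK_items_def)
  have x: "x \<notin> GK_items G s" using fr by (auto simp: GK_items_def)
  have 0: "buffer_ok s0" "live s0" "flushing s0 = {}" "gained s0 = gained s"
    "GK_items G s0 = (if GK G x then {x} else {}) \<union> GK_items G s"
    "buffer s0 \<subseteq> insert x (buffer s)"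
    "num_GK G s + (if GK G x then 1 else 0) < B \<Longrightarrow> admission_inv adm (if known x then u else Suc u) s0"
    using s0(1) by (auto simp: fill_successor_def)
  show "buffer_ok s0" by (rule 0)
  show "state_ok s'" unfolding s0(2) by (rule state_ok_start_flush[OF 0(1)])
  show "live s'" using 0(2) by (simp add: s0(2) live_def)
  show "buffer s' \<subseteq> insert x (buffer s)" using 0(6) by (simp add: s0(2))
  have num: "num_GK G s0 = num_GK G s + (if GK G x then 1 else 0)"
    using fin x 0(5) by (simp add: num_GK_eq)
  show "s' = s0 \<and> num_GK G s' = num_GK G s + (if GK G x then 1 else 0) \<and>
       flushing s' = {} \<and> admission_inv adm (if known x then u else Suc u) s'"
    if "num_GK G s + (if GK G x then 1 else 0) < B"
  proof -
    have "s' = s0" unfolding s0(2) using that num by (intro start_flush_below) simp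
    then show ?thesis using num 0 that by simp
  qed
  show "flushing s' \<noteq> {}" if "\<not> num_GK G s + (if GK G x then 1 else 0) < B"
    using 0(1)
  proof (cases rule: start_flush_cases)
    case same
    then show ?thesis using that num 0(3) by simp
  next
    case start
    then show ?thesis using B_ge_2 by (auto simp: s0(2))
  qed
  show "secured G s0 = secured G s + (if GK G x then profit (pkt x) else 0)"
    using 0 s fin x by (simp add: secured_fill total_profit_insert)
  show "flush_secured s0 = flush_secured s" using 0 s by (simp add: flush_secured_fill)
  show "flush_work s0 = 0" using 0 by simp
qed

text \<open>The equation holds for every valuation of the admitted packet, which makes the induction over
  the remaining arrivals go through; for \<open>u = 0\<close> it says that the admitted packet is uniformly
  distributed among the unknown packets of the cycle.\<close>

lemma reservoir_sampling:
  fixes f :: "ident option \<Rightarrow> real"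
  assumes "state_ok s" "live s" "flushing s = {}" "fresh_items xs s" "admission_inv True u s"
    and "num_GK G s + length (filter (GK G) xs) < B"
  shows "real (u + length (filter (\<lambda>x. \<not> known x) xs)) *
       measure_pmf.expectation (sa_arrivals P G True u xs s) (\<lambda>s'. f (admitted s')) =
     real u * f (admitted s) + (\<Sum>x\<leftarrow>filter (\<lambda>x. \<not> known x) xs. f (Some (ident x)))"
  using assms
proof (induction xs arbitrary: u s)
  case Nil
  then show ?case by simp
next
  case (Cons x xs)
  note x = fresh_items_Cons[OF Cons.prems(4)]
  let ?E = "\<lambda>u s. measure_pmf.expectation (sa_arrivals P G True u xs s) (\<lambda>s'. f (admitted s'))"
  let ?U = "length (filter (\<lambda>x. \<not> known x) xs)"
  let ?S = "\<Sum>x\<leftarrow>filter (\<lambda>x. \<not> known x) xs. f (Some (ident x))"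
  let ?m = "if known x then u else Suc u"
  have num: "num_GK G s + (if GK G x then 1 else 0) < B"
    using Cons.prems(6) by auto
  have IH: "real (?m + ?U) * ?E ?m s' = real ?m * f (admitted s') + ?S"
    if s': "s' \<in> set_pmf (fill_arrival P G True ?m x s)" for s'
  proof -
    obtain s0 where s0: "s' = start_flush_if_Gfull P G s0" "fill_successor True u x s s0"
      using fill_arrival_support[OF Cons.prems(1,2,3,5) x(1-3) s'] by blast
    note st = fill_step[OF Cons.prems(1,3) x(1) s0(2,1)]
    show ?thesis
      by (rule Cons.IH) (use st x(4) num Cons.prems(6) in auto)
  qed
  show ?case
  proof (cases "known x")
    case True
    obtain s1 where s1: "fill_arrival P G True u x s = return_pmf s1" "admitted s1 = admitted s"
    proof (cases "GK G x")
      case GK: True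
      then have "num_GK G s + 1 < B" using num by simp
      then show ?thesis
        using that fill_arrival_GK(2)[OF Cons.prems(1,2,3,5) x(1-3) GK] GK
        by (simp add: fill_arrival_def)
    next
      case False
      then show ?thesis
        using that[of "accept_if_space P x s"] True
        by (auto simp: fill_arrival_def accept_if_space_def accept_def)
    qed
    then show ?thesis
      using IH[of s1] True Cons.prems(3) by (simp add: bind_return_pmf)
  next
    case unk: False
    then have nGK: "\<not> GK G x" by (simp add: GK_def)
    show ?thesis
    proof (cases "u = 0")
      case True
      then show ?thesis
        using IH[of "(accept x (make_room P G s))\<lparr>admitted := Some (ident x)\<rparr>"] unk nGK Cons.prems(3)
        by (simp add: fill_arrival_def bind_return_pmf)
    next
      case u: False
      let ?m = "real (Suc u)"
      let ?s1 = "(accept x (drop_admitted s))\<lparr>admitted := Some (ident x)\<rparr>"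
      let ?s2 = "accept_if_space P x s"
      let ?g = "\<lambda>replace. if replace then ?s1 else ?s2"
      have fa: "fill_arrival P G True (Suc u) x s = map_pmf ?g (bernoulli_pmf (1 / ?m))"
        using unk nGK u by (simp add: fill_arrival_def)
      \<comment> \<open>Since u > 0, the probability 1/(u+1) lies strictly between 0 and 1; both
        outcomes are reachable and the induction hypothesis holds for each.\<close>
      have supp: "set_pmf (bernoulli_pmf (1 / ?m)) = UNIV"
        using u by (intro set_pmf_bernoulli) auto
      have "?g ` UNIV = {?s1, ?s2}" by (auto simp: UNIV_bool)
      then have mem: "?s1 \<in> set_pmf (fill_arrival P G True (Suc u) x s)"
        "?s2 \<in> set_pmf (fill_arrival P G True (Suc u) x s)"
        unfolding fa set_map_pmf supp by simp_all
      have IH1: "(?m + ?U) * ?E (Suc u) ?s1 = ?m * f (Some (ident x)) + ?S"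
        using IH[of ?s1] mem(1) unk by (simp add: add.assoc)
      have "admitted ?s2 = admitted s" by (simp add: accept_if_space_def accept_def)
      then have IH2: "(?m + ?U) * ?E (Suc u) ?s2 = ?m * f (admitted s) + ?S"
        using IH[of ?s2] mem(2) unk by (simp add: add.assoc)
      have "measure_pmf.expectation (sa_arrivals P G True u (x # xs) s) (\<lambda>s'. f (admitted s')) =
         measure_pmf.expectation (bernoulli_pmf (1 / ?m)) (\<lambda>b. ?E (Suc u) (?g b))"
        using unk Cons.prems(3)
        by (simp add: fa bind_map_pmf expectation_bind_finite finite_sa_arrivals del: of_nat_Suc)
      also have "\<dots> = ?E (Suc u) ?s1 * (1 / ?m) + ?E (Suc u) ?s2 * (1 - 1 / ?m)"
        by (subst integral_bernoulli_pmf) auto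
      finally have E: "measure_pmf.expectation (sa_arrivals P G True u (x # xs) s)
          (\<lambda>s'. f (admitted s')) =
        ?E (Suc u) ?s1 * (1 / ?m) + ?E (Suc u) ?s2 * (1 - 1 / ?m)" .
      have "(?m + ?U) * measure_pmf.expectation (sa_arrivals P G True u (x # xs) s)
          (\<lambda>s'. f (admitted s')) =
        ((?m + ?U) * ?E (Suc u) ?s1) * (1 / ?m) + ((?m + ?U) * ?E (Suc u) ?s2) * (1 - 1 / ?m)"
        unfolding E by (simp only: distrib_left mult.assoc)
      \<comment> \<open>The reservoir step with m = u + 1.\<close>
      also have "\<dots> = real u * f (admitted s) + (f (Some (ident x)) + ?S)"
        unfolding IH1 IH2 by (subst weighted_average) simp_all
      finally show ?thesis using unk by (simp add: algebra_simps)
    qed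
  qed
qed

end

section \<open>The potential along one cycle\<close>

lemma real_sum_list_map: "real (\<Sum>x\<leftarrow>xs. f x) = (\<Sum>x\<leftarrow>xs. real (f x))"
  by (induction xs) auto

locale charging = selected_class P G pk W b c
  for P :: sa_params and G :: "packet set" and pk :: "ident \<Rightarrow> packet" and W b c :: nat +
  fixes p :: "nat \<Rightarrow> real" and al be :: real and M :: nat
  assumes p_nonneg: "0 \<le> p t"
    and al: "1 \<le> al" "real M \<le> al * admit_prob P"
    and be: "0 \<le> be"
    and flush_budget: "L \<le> B * b \<Longrightarrow> sum p {t..<t + L} \<le> be * real (B * c)"
begin

text \<open>A flush phase lasts exactly \<open>flush_work\<close> further cycles, so the offline profit arriving in all
  of them is charged at the moment the phase starts.\<close>

definition potential :: "nat \<Rightarrow> sa_state \<Rightarrow> real" where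
  "potential t s = al * real (secured G s) + be * real (flush_secured s) - sum p {..<t + flush_work s}"

lemma sum_p_split: "sum p {..<t + L} = sum p {..<t} + sum p {t..<t + L}"
  by (subst sum.union_disjoint[symmetric]) (auto intro: sum.cong)

text \<open>At the start of a flush phase \<open>secured\<close> is unchanged,
  \<open>flush_secured\<close> rises by at least \<open>B * c\<close>, and \<open>flush_work\<close>
  jumps from 0 to at most \<open>B * b\<close>; \<open>flush_budget\<close> balances the last
  two.\<close>

lemma potential_start_flush:
  assumes "buffer_ok s"
  shows "potential t s \<le> potential t (start_flush_if_Gfull P G s)"
proof (cases "start_flush_if_Gfull P G s = s")
  case False
  let ?s = "start_flush_if_Gfull P G s"
  note st = flush_start[OF assms False]
  have "sum p {..<t + flush_work ?s} \<le> sum p {..<t} + be * real (B * c)"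
    using sum_p_split flush_budget[OF st(2)] by simp
  moreover have "be * real (flush_secured s) + be * real (B * c) \<le> be * real (flush_secured ?s)"
    using st(3) be by (metis distrib_left mult_left_mono of_nat_add of_nat_mono)
  ultimately show ?thesis
    using st(1) by (simp add: potential_def secured_start_flush[OF assms])
qed simp

lemma potential_transmit:
  assumes "buffer_ok s"
  shows "potential t s \<le> potential t (transmit P G s)"
proof -
  note tr = transmit_only_props[OF assms]
  have "al * real (secured G s) \<le> al * real (secured G (transmit_only s))"
    "be * real (flush_secured s) \<le> be * real (flush_secured (transmit_only s))"
    using tr al be by (auto intro!: mult_left_mono)
  then have "potential t s \<le> potential t (transmit_only s)"
    using tr by (simp add: potential_def)
  also have "\<dots> \<le> potential t (transmit P G s)"
    unfolding transmit_eq by (rule potential_start_flush[OF tr(1)])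
  finally show ?thesis .
qed

text \<open>Time advances by one while \<open>flush_work\<close> falls by one, so the set of charged
  cycles stays the same: this cycle was prepaid.\<close>

lemma potential_process_flush:
  assumes "state_ok s" "live s" "flushing s \<noteq> {}"
  shows "potential t s \<le> potential (Suc t) (sa_process P G s)"
proof -
  have bok: "buffer_ok s" using assms by (simp add: state_ok_def)
  note pr = process_flush[OF bok assms(2,3)]
  have "potential (Suc t) (process_only s) = potential t s"
    using pr assms by (simp add: potential_def secured_flush)
  then show ?thesis
    unfolding sa_process_eq using potential_start_flush[OF pr(1), of "Suc t"] by simp
qed

lemma potential_process_fill:
  assumes "state_ok s" "live s" "flushing s = {}" "admitted_unknown s"
  shows "potential t s - p t + al * real (admission_value (admitted s)) \<le>
    potential (Suc t) (sa_process P G s)"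
proof -
  have bok: "buffer_ok s" using assms by (simp add: state_ok_def)
  note pr = process_fill[OF bok assms(2-4)]
  have "al * real (secured G s) + al * real (admission_value (admitted s)) \<le>
      al * real (secured G (process_only s))"
    using pr(4) al by (metis distrib_left mult_left_mono of_nat_add of_nat_mono order_trans zero_le_one)
  then have "potential t s - p t + al * real (admission_value (admitted s)) \<le>
      potential (Suc t) (process_only s)"
    using pr assms by (simp add: potential_def flush_secured_fill)
  then show ?thesis
    unfolding sa_process_eq using potential_start_flush[OF pr(1), of "Suc t"] by simp
qed

text \<open>Whether a flush phase starts during the arrivals of a cycle depends only on the number of known
  packets of the selected class among them, not on the random choices; this is why the admittance
  probability can be charged separately in the cycles without flushing.\<close>

lemma arrivals_support:
  assumes "state_ok s" "live s" "fresh_items xs s"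
    and "flushing s = {} \<Longrightarrow> admission_inv adm u s"
    and "s' \<in> set_pmf (sa_arrivals P G adm u xs s)"
  shows "state_ok s' \<and> live s' \<and> buffer s' \<subseteq> set xs \<union> buffer s \<and> potential t s \<le> potential t s' \<and>
    (flushing s \<noteq> {} \<longrightarrow> flushing s' \<noteq> {}) \<and>
    (flushing s = {} \<longrightarrow>
      (if num_GK G s + length (filter (GK G) xs) < B
       then flushing s' = {} \<and> admitted_unknown s' \<and>
         potential t s + al * real (\<Sum>x\<leftarrow>filter (GK G) xs. profit (pkt x)) \<le> potential t s'
       else flushing s' \<noteq> {}))"
  using assms
proof (induction xs arbitrary: u s)
  case Nil
  then show ?case by (auto simp: state_ok_def admission_inv_def)
next
  case (Cons x xs)
  note x = fresh_items_Cons[OF Cons.prems(3)]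
  let ?m = "if known x then u else Suc u"
  show ?case
  proof (cases "flushing s = {}")
    case flush: False
    let ?s = "flush_arrival P G x s"
    have bok: "buffer_ok s" using Cons.prems by (simp add: state_ok_def)
    note fa = flush_arrival_props[OF bok flush x(1,2)]
    have fl: "flushing ?s \<noteq> {}" using fa flush by simp
    have s': "s' \<in> set_pmf (sa_arrivals P G adm ?m xs ?s)"
      using Cons.prems(5) flush by (simp add: bind_return_pmf)
    have "state_ok ?s" using fa fl by (simp add: state_ok_def)
    moreover have "live ?s" using fa(5) Cons.prems(2) x(3) by (auto simp: live_def)
    ultimately have "state_ok s' \<and> live s' \<and> buffer s' \<subseteq> set xs \<union> buffer ?s \<and>
        potential t ?s \<le> potential t s' \<and> flushing s' \<noteq> {}"
      using Cons.IH[of ?s ?m] x(4)[OF fa(5)] s' fl by blast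
    \<comment> \<open>Packets arriving during a flush phase enter no term of the potential, so
      accepting them or pushing them out is free.\<close>
    moreover have "potential t ?s = potential t s"
      using fa flush by (simp add: potential_def secured_flush flush_secured_def flush_work_def)
    ultimately show ?thesis using fa(5) flush by auto
  next
    case fill: True
    obtain s1 where s1: "s1 \<in> set_pmf (fill_arrival P G adm ?m x s)"
      "s' \<in> set_pmf (sa_arrivals P G adm ?m xs s1)"
      using Cons.prems(5) fill by (auto simp: Let_def)
    note adm = Cons.prems(4)[OF fill]
    obtain s0 where s0: "s1 = start_flush_if_Gfull P G s0" "fill_successor adm u x s s0"
      using fill_arrival_support[OF Cons.prems(1,2) fill adm x(1-3) s1(1)] by blast
    note st = fill_step[OF Cons.prems(1) fill x(1) s0(2,1)]
    let ?g = "if GK G x then profit (pkt x) else 0"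
    have "potential t s0 = potential t s + al * real ?g"
      using st fill by (simp add: potential_def algebra_simps)
    moreover have "potential t s0 \<le> potential t s1"
      unfolding s0 by (rule potential_start_flush) (rule st)
    ultimately have pot: "potential t s + al * real ?g \<le> potential t s1" by simp
    have nn: "0 \<le> al * real ?g" using al by simp
    show ?thesis
    proof (cases "num_GK G s + (if GK G x then 1 else 0) < B")
      case True
      note st1 = st(4)[OF True]
      have IH: "state_ok s' \<and> live s' \<and> buffer s' \<subseteq> set xs \<union> buffer s1 \<and>
        potential t s1 \<le> potential t s' \<and>
        (if num_GK G s1 + length (filter (GK G) xs) < B
         then flushing s' = {} \<and> admitted_unknown s' \<and>
           potential t s1 + al * real (\<Sum>x\<leftarrow>filter (GK G) xs. profit (pkt x)) \<le> potential t s'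
         else flushing s' \<noteq> {})"
        using Cons.IH[OF st(1,2) x(4)[OF st(3)] _ s1(2)] st1 by blast
      then have "buffer s' \<subseteq> set (x # xs) \<union> buffer s" using st(3) by auto
      then show ?thesis
        using IH st1 fill pot nn by (simp add: algebra_simps split: if_splits)
    next
      case False
      note fl = st(5)[OF False]
      have IH: "state_ok s' \<and> live s' \<and> buffer s' \<subseteq> set xs \<union> buffer s1 \<and>
        potential t s1 \<le> potential t s' \<and> flushing s' \<noteq> {}"
        using Cons.IH[OF st(1,2) x(4)[OF st(3)] _ s1(2)] fl by blast
      have "buffer s' \<subseteq> set (x # xs) \<union> buffer s" using IH st(3) by auto
      moreover have "\<not> num_GK G s + length (filter (GK G) (x # xs)) < B"
        using False by (auto split: if_splits)
      ultimately show ?thesis using IH fill pot nn by (simp del: filter.simps)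
    qed
  qed
qed

definition cycle_ok :: "sa_state \<Rightarrow> bool" where
  "cycle_ok s \<longleftrightarrow> state_ok s \<and> admitted s = None"

lemma transmit_props:
  assumes "cycle_ok s"
  shows "state_ok (transmit P G s)" "live (transmit P G s)" "admission_inv adm 0 (transmit P G s)"
    "buffer (transmit P G s) = {x \<in> buffer s. remaining x \<noteq> 0}"
proof -
  have bok: "buffer_ok s" using assms by (simp add: cycle_ok_def state_ok_def)
  note tr = transmit_only_props[OF bok]
  show "state_ok (transmit P G s)" unfolding transmit_eq by (rule state_ok_start_flush[OF tr(1)])
  show "live (transmit P G s)" using tr(2) by (simp add: transmit_eq live_def)
  show "buffer (transmit P G s) = {x \<in> buffer s. remaining x \<noteq> 0}" using tr(5) by (simp add: transmit_eq)
  have "admitted (transmit P G s) = None" using tr(3) assms by (simp add: transmit_eq cycle_ok_def)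
  then show "admission_inv adm 0 (transmit P G s)"
    by (simp add: admission_inv_def admitted_unknown_def)
qed

lemma process_props:
  assumes "state_ok s" "live s" "flushing s = {} \<Longrightarrow> admitted_unknown s"
  shows "cycle_ok (sa_process P G s)" "ident ` buffer (sa_process P G s) \<subseteq> ident ` buffer s"
    "buffer s \<noteq> {} \<Longrightarrow> sum remaining (buffer s) = Suc (sum remaining (buffer (sa_process P G s)))"
    "buffer s = {} \<Longrightarrow> buffer (sa_process P G s) = {}"
proof -
  have bok: "buffer_ok s" using assms by (simp add: state_ok_def)
  have "buffer_ok (process_only s) \<and> ident ` buffer (process_only s) \<subseteq> ident ` buffer s \<and>
    (buffer s \<noteq> {} \<longrightarrow> sum remaining (buffer s) = Suc (sum remaining (buffer (process_only s)))) \<and>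
    (buffer s = {} \<longrightarrow> buffer (process_only s) = {})"
  proof (cases "flushing s = {}")
    case True
    then show ?thesis using process_fill[OF bok assms(2) True assms(3)[OF True]] by auto
  next
    case False
    then show ?thesis using process_flush[OF bok assms(2) False] by auto
  qed
  then show "cycle_ok (sa_process P G s)" "ident ` buffer (sa_process P G s) \<subseteq> ident ` buffer s"
    "buffer s \<noteq> {} \<Longrightarrow> sum remaining (buffer s) = Suc (sum remaining (buffer (sa_process P G s)))"
    "buffer s = {} \<Longrightarrow> buffer (sa_process P G s) = {}"
    using state_ok_start_flush[of "process_only s"]
    by (auto simp: sa_process_eq cycle_ok_def)
qed

lemma cycle_support:
  assumes s: "cycle_ok s" and fr: "fresh_items xs s"
    and s': "s' \<in> set_pmf (sa_cycle P G xs s)"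
  shows "cycle_ok s'" "ident ` buffer s' \<subseteq> ident ` buffer s \<union> ident ` set xs"
proof -
  note tr = transmit_props[OF s]
  obtain adm s2 where s2: "s2 \<in> set_pmf (sa_arrivals P G adm 0 xs (transmit P G s))"
    "s' = sa_process P G s2"
    using s' by (auto simp: sa_cycle_def)
  have fr': "fresh_items xs (transmit P G s)"
    using fr unfolding fresh_items_def tr(4) by (auto simp: image_iff)
  have 2: "state_ok s2 \<and> live s2 \<and> buffer s2 \<subseteq> set xs \<union> buffer (transmit P G s) \<and>
      (flushing s2 = {} \<longrightarrow> admitted_unknown s2)"
    using arrivals_support[OF tr(1,2) fr' tr(3) s2(1), of 0] by (auto split: if_splits)
  then have "ident ` buffer s2 \<subseteq> ident ` buffer s \<union> ident ` set xs" unfolding tr(4) by auto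
  then show "cycle_ok s'" "ident ` buffer s' \<subseteq> ident ` buffer s \<union> ident ` set xs"
    using process_props[of s2] 2 unfolding s2(2) by blast+
qed

lemma sum_list_filter_split:
  "(\<Sum>x\<leftarrow>xs. if pkt x \<in> G then profit (pkt x) else 0) =
    (\<Sum>x\<leftarrow>filter (GK G) xs. profit (pkt x)) +
    (\<Sum>x\<leftarrow>filter (\<lambda>x. \<not> known x) xs. if pkt x \<in> G then profit (pkt x) else 0)"
  by (induction xs) (auto simp: GK_def)

text \<open>Because the condition on GK-packets does not involve the coins, either every outcome is
  flushing at the processing step, and the potential is non-decreasing outcome by outcome, or none
  is. In the second case the known packets pay for themselves and the unknown ones are paid on
  average, through the admittance cycles alone.\<close>

lemma potential_drift:
  assumes s: "cycle_ok s" and fr: "fresh_items xs s"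
    and M: "length (filter (\<lambda>x. \<not> known x) xs) \<le> M"
    and p: "p t \<le> real (\<Sum>x\<leftarrow>xs. if pkt x \<in> G then profit (pkt x) else 0)"
  shows "potential t s \<le> measure_pmf.expectation (sa_cycle P G xs s) (potential (Suc t))"
proof -
  let ?s = "transmit P G s"
  let ?r = "admit_prob P"
  let ?A = "\<lambda>adm. sa_arrivals P G adm 0 xs ?s"
  define E where "E adm = measure_pmf.expectation (?A adm) (\<lambda>s'. potential (Suc t) (sa_process P G s'))" for adm
  note tr = transmit_props[OF s]
  have fr': "fresh_items xs ?s"
    using fr unfolding fresh_items_def tr(4) by (auto simp: image_iff)
  have r: "0 < ?r" "?r \<le> 1" using valid by (auto simp: valid_sa_params_def)
  have "measure_pmf.expectation (sa_cycle P G xs s) (potential (Suc t)) =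
      measure_pmf.expectation (bernoulli_pmf ?r) E"
    unfolding sa_cycle_def E_def
    by (subst expectation_bind_finite) (auto simp: finite_sa_arrivals)
  also have "\<dots> = ?r * E True + (1 - ?r) * E False"
    using r by (simp add: mult.commute)
  finally have exp: "measure_pmf.expectation (sa_cycle P G xs s) (potential (Suc t)) =
    ?r * E True + (1 - ?r) * E False" .
  have "potential t s \<le> potential t ?s"
    using s by (intro potential_transmit) (simp add: cycle_ok_def state_ok_def)
  also have "\<dots> \<le> ?r * E True + (1 - ?r) * E False"
  proof (cases "flushing ?s = {} \<and> num_GK G ?s + length (filter (GK G) xs) < B")
    case False
    have "potential t ?s \<le> E adm" for adm
    proof -
      have "potential t ?s \<le> potential (Suc t) (sa_process P G s')" if "s' \<in> set_pmf (?A adm)" for s'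
      proof -
        have "state_ok s'" "live s'" "potential t ?s \<le> potential t s'" "flushing s' \<noteq> {}"
          using arrivals_support[OF tr(1,2) fr' tr(3) that, of t] False by (auto split: if_splits)
        then show ?thesis using potential_process_flush[of s' t] by linarith
      qed
      then have "measure_pmf.expectation (?A adm) (\<lambda>_. potential t ?s) \<le> E adm"
        unfolding E_def by (intro expectation_mono_finite finite_sa_arrivals)
      then show ?thesis by simp
    qed
    then have "?r * potential t ?s + (1 - ?r) * potential t ?s \<le> ?r * E True + (1 - ?r) * E False"
      using r by (intro add_mono mult_left_mono) auto
    then show ?thesis by (simp add: algebra_simps)
  next
    case True
    define K where "K = real (\<Sum>x\<leftarrow>filter (GK G) xs. profit (pkt x))"
    define U where "U = real (\<Sum>x\<leftarrow>filter (\<lambda>x. \<not> known x) xs. if pkt x \<in> G then profit (pkt x) else 0)"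
    define F where "F adm = measure_pmf.expectation (?A adm) (\<lambda>s'. real (admission_value (admitted s')))" for adm
    have E: "potential t ?s + al * K - p t + al * F adm \<le> E adm" for adm
    proof -
      have "potential t ?s + al * K - p t + al * real (admission_value (admitted s')) \<le>
          potential (Suc t) (sa_process P G s')" if "s' \<in> set_pmf (?A adm)" for s'
      proof -
        have "state_ok s'" "live s'" "flushing s' = {}" "admitted_unknown s'"
          "potential t ?s + al * K \<le> potential t s'"
          using arrivals_support[OF tr(1,2) fr' tr(3) that, of t] True
          by (auto simp: K_def split: if_splits)
        then show ?thesis using potential_process_fill[of s' t] by linarith
      qed
      then have "measure_pmf.expectation (?A adm)
          (\<lambda>s'. potential t ?s + al * K - p t + al * real (admission_value (admitted s'))) \<le> E adm"
        unfolding E_def by (intro expectation_mono_finite finite_sa_arrivals)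
      then show ?thesis
        by (simp add: F_def integrable_measure_pmf_finite finite_sa_arrivals)
    qed
    have F_nonneg: "0 \<le> F adm" for adm
      unfolding F_def by (intro Bochner_Integration.integral_nonneg) simp
    have "real (length (filter (\<lambda>x. \<not> known x) xs)) * F True =
        (\<Sum>x\<leftarrow>filter (\<lambda>x. \<not> known x) xs. real (admission_value (Some (ident x))))"
      unfolding F_def
      using reservoir_sampling[OF tr(1,2) _ fr' tr(3), of "\<lambda>a. real (admission_value a)"] True by simp
    also have "\<dots> = U"
    proof -
      have "admission_value (Some (ident x)) = (if pkt x \<in> G then profit (pkt x) else 0)"
        if "x \<in> set xs" for x
        using fr that by (auto simp: fresh_items_def item_ok_def admission_value_def)
      then have "map (\<lambda>x. real (admission_value (Some (ident x)))) (filter (\<lambda>x. \<not> known x) xs) =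
          map (\<lambda>x. real (if pkt x \<in> G then profit (pkt x) else 0)) (filter (\<lambda>x. \<not> known x) xs)"
        by simp
      then show ?thesis unfolding U_def by (simp only: real_sum_list_map)
    qed
    finally have "U = real (length (filter (\<lambda>x. \<not> known x) xs)) * F True" by simp
    \<comment> \<open>Sampling gives each unknown arrival a chance of one over their number. That
      number is at most \<open>M\<close>, and \<open>al\<close> times the admittance probability is
      at least \<open>M\<close>.\<close>
    also have "\<dots> \<le> real M * F True" using M F_nonneg by (intro mult_right_mono) auto
    also have "\<dots> \<le> al * ?r * F True" using al(2) F_nonneg by (intro mult_right_mono) auto
    finally have U: "U \<le> ?r * (al * F True)" by (simp add: mult_ac)
    have "p t \<le> K + U" using p sum_list_filter_split[of xs] by (simp only: K_def U_def of_nat_add)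
    moreover have "K \<le> al * K" using al(1) by (simp add: K_def mult_le_cancel_right1)
    ultimately have "potential t ?s \<le> potential t ?s + al * K - p t + ?r * (al * F True)"
      using U by linarith
    also have "\<dots> = ?r * (potential t ?s + al * K - p t + al * F True)
        + (1 - ?r) * (potential t ?s + al * K - p t)"
      by (simp add: algebra_simps)
    also have "\<dots> \<le> ?r * E True + (1 - ?r) * E False"
    proof (intro add_mono mult_left_mono)
      \<comment> \<open>In a cycle without admittance only the nonnegativity of the admission value
        is used.\<close>
      show "potential t ?s + al * K - p t \<le> E False"
        using E[of False] mult_nonneg_nonneg[OF _ F_nonneg[of False], of al] al(1) by linarith
    qed (use E r in auto)
    finally show ?thesis .
  qed
  finally show ?thesis using exp by simp
qed

end

section \<open>The potential along a run\<close>

lemma distinct_arrival_idents: "distinct (map ident (arrivals_at arr t))"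
  by (auto simp: arrivals_at_def distinct_map inj_on_def comp_def)

lemma valid_arrivals_nth:
  assumes "valid_arrivals W V M arr" "t < length arr" "k < length (arr ! t)"
  shows "work (arr ! t ! k) \<in> {1..W}" "profit (arr ! t ! k) \<in> {1..V}"
  using assms nth_mem[OF assms(2)] nth_mem[OF assms(3)] unfolding valid_arrivals_def by blast+

locale charged_run = charging P G "\<lambda>i. arr ! fst i ! snd i" W b c p al be M
  for P :: sa_params and G :: "packet set" and arr :: arrival_seq and W b c :: nat
    and p :: "nat \<Rightarrow> real" and al be :: real and M :: nat +
  fixes V :: nat
  assumes arr: "valid_arrivals W V M arr"
    and p_le: "p t \<le> real (\<Sum>x\<leftarrow>arrivals_at arr t. if pkt x \<in> G then profit (pkt x) else 0)"
begin

text \<open>An identity begins with its arrival cycle, so the bound \<open>fst i < n\<close> is what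
  keeps the arrivals of cycle \<open>n\<close> distinct from everything buffered.\<close>

definition run_ok :: "nat \<Rightarrow> sa_state \<Rightarrow> bool" where
  "run_ok n s \<longleftrightarrow> cycle_ok s \<and> (\<forall>i\<in>ident ` buffer s. fst i < n)"

lemma fresh_arrivals:
  assumes "run_ok n s"
  shows "fresh_items (arrivals_at arr n) s"
proof -
  have "item_ok x \<and> remaining x = work (pkt x)" if "x \<in> set (arrivals_at arr n)" for x
    using that valid_arrivals_nth(1)[OF arr]
    by (auto simp: arrivals_at_def item_ok_def split: if_splits)
  moreover have "fst (ident x) = n" if "x \<in> set (arrivals_at arr n)" for x
    using that by (auto simp: arrivals_at_def split: if_splits)
  ultimately show ?thesis
    using assms distinct_arrival_idents unfolding fresh_items_def run_ok_def by fastforce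
qed

lemma unknown_arrivals: "length (filter (\<lambda>x. \<not> known x) (arrivals_at arr n)) \<le> M"
proof (cases "n < length arr")
  case True
  then have "length (filter (\<lambda>p. \<not> is_K p) (arr ! n)) \<le> M"
    using arr by (auto simp: valid_arrivals_def)
  moreover have "filter (\<lambda>p. \<not> is_K p) (arr ! n) = filter (\<lambda>p. \<not> is_K p) (map pkt (arrivals_at arr n))"
    using True by (simp add: arrivals_at_def comp_def map_nth)
  moreover have "filter (\<lambda>p. \<not> is_K p) (map pkt (arrivals_at arr n)) =
      map pkt (filter (\<lambda>x. \<not> is_K (pkt x)) (arrivals_at arr n))"
    by (simp add: filter_map comp_def)
  moreover have "filter (\<lambda>x. \<not> is_K (pkt x)) (arrivals_at arr n) =
      filter (\<lambda>x. \<not> known x) (arrivals_at arr n)"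
    by (rule filter_cong) (auto simp: arrivals_at_def known_def)
  ultimately show ?thesis by simp
qed (simp add: arrivals_at_def)

lemma run_support: "s \<in> set_pmf (sa_run P G arr n) \<Longrightarrow> run_ok n s"
proof (induction n arbitrary: s)
  case 0
  then show ?case using B_ge_2
    by (simp add: run_ok_def cycle_ok_def state_ok_def buffer_ok_def sa_init_def num_GK_def)
next
  case (Suc n)
  then obtain s0 where s0: "s0 \<in> set_pmf (sa_run P G arr n)"
    "s \<in> set_pmf (sa_cycle P G (arrivals_at arr n) s0)" by auto
  have ok: "run_ok n s0" by (rule Suc.IH[OF s0(1)])
  then have "cycle_ok s0" by (simp add: run_ok_def)
  note cy = cycle_support[OF this fresh_arrivals[OF ok] s0(2)]
  have "fst i < Suc n" if "i \<in> ident ` buffer s" for i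
  proof -
    have "i \<in> ident ` buffer s0 \<or> i \<in> ident ` set (arrivals_at arr n)" using that cy(2) by auto
    then show ?thesis
    proof
      assume "i \<in> ident ` buffer s0"
      then show ?thesis using ok by (auto simp: run_ok_def less_Suc_eq)
    next
      assume "i \<in> ident ` set (arrivals_at arr n)"
      then show ?thesis by (auto simp: arrivals_at_def split: if_splits)
    qed
  qed
  then show ?case using cy(1) by (simp add: run_ok_def)
qed

text \<open>The drift bound holds at every reachable state, hence survives averaging over the run;
  the potential starts at 0.\<close>

lemma expected_potential: "0 \<le> measure_pmf.expectation (sa_run P G arr n) (potential n)"
proof (induction n)
  case 0
  then show ?case by (simp add: potential_def secured_fill flush_secured_fill sa_init_def
        GK_items_def total_profit_def)
next
  case (Suc n)
  have "measure_pmf.expectation (sa_run P G arr n) (potential n) \<le>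
    measure_pmf.expectation (sa_run P G arr n)
      (\<lambda>s. measure_pmf.expectation (sa_cycle P G (arrivals_at arr n) s) (potential (Suc n)))"
  proof (rule expectation_mono_finite[OF finite_sa_run])
    fix s assume "s \<in> set_pmf (sa_run P G arr n)"
    then have ok: "run_ok n s" by (rule run_support)
    then have "cycle_ok s" by (simp add: run_ok_def)
    then show "potential n s \<le>
        measure_pmf.expectation (sa_cycle P G (arrivals_at arr n) s) (potential (Suc n))"
      by (rule potential_drift[OF _ fresh_arrivals[OF ok] unknown_arrivals p_le])
  qed
  also have "\<dots> = measure_pmf.expectation (sa_run P G arr (Suc n)) (potential (Suc n))"
    by (simp add: expectation_bind_finite finite_sa_run finite_sa_cycle)
  finally show ?case using Suc by simp
qed

section \<open>Emptying the buffer after the last arrival\<close>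

lemma drain_step:
  assumes "length arr \<le> n" "s \<in> set_pmf (sa_run P G arr n)" "s' \<in> set_pmf (sa_cycle P G (arrivals_at arr n) s)"
  shows "sum remaining (buffer s') \<le> sum remaining (buffer s) - 1"
    "sum remaining (buffer s) = 0 \<Longrightarrow> buffer s' = {}"
proof -
  have cy: "cycle_ok s" using run_support[OF assms(2)] by (simp add: run_ok_def)
  have s': "s' = sa_process P G (transmit P G s)"
    using assms(1,3) by (auto simp: sa_cycle_def arrivals_at_def)
  note tr = transmit_props[OF cy]
  have fin: "finite (buffer s)" using cy by (simp add: cycle_ok_def state_ok_def buffer_ok_def)
  have au: "admitted_unknown (transmit P G s)" using tr(3) by (simp add: admission_inv_def)
  note pr = process_props[OF tr(1,2) au]
  have sum: "sum remaining (buffer (transmit P G s)) = sum remaining (buffer s)"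
    unfolding tr(4) by (rule sum.mono_neutral_left) (use fin in auto)
  show "sum remaining (buffer s') \<le> sum remaining (buffer s) - 1"
    using pr(3,4) sum unfolding s' by (cases "buffer (transmit P G s) = {}") auto
  assume "sum remaining (buffer s) = 0"
  then have "buffer (transmit P G s) = {}" unfolding tr(4) using fin by auto
  then show "buffer s' = {}" using pr(4) s' by simp
qed

lemma drain:
  assumes "s \<in> set_pmf (sa_run P G arr (length arr + k))"
  shows "sum remaining (buffer s) \<le> B * W - k"
  using assms
proof (induction k arbitrary: s)
  case 0
  then have ok: "cycle_ok s" using run_support by (auto simp: run_ok_def)
  then have "sum remaining (buffer s) \<le> (\<Sum>x\<in>buffer s. W)"
    by (intro sum_mono) (auto simp: cycle_ok_def state_ok_def buffer_ok_def item_ok_def)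
  also have "\<dots> \<le> B * W" using ok by (simp add: cycle_ok_def state_ok_def buffer_ok_def)
  finally show ?case by simp
next
  case (Suc k)
  then obtain s0 where s0: "s0 \<in> set_pmf (sa_run P G arr (length arr + k))"
    "s \<in> set_pmf (sa_cycle P G (arrivals_at arr (length arr + k)) s0)" by auto
  then show ?case using drain_step(1)[OF _ s0] Suc.IH[OF s0(1)] by simp
qed

text \<open>At most \<open>B * W\<close> units of work are left when arrivals cease, and each later
  cycle removes one while any is left. The inequality is strict because a completed packet leaves
  only in the transmission step of the next cycle.\<close>

lemma run_empty:
  assumes "length arr + B * W < n" "s \<in> set_pmf (sa_run P G arr n)"
  shows "buffer s = {}"
proof -
  define m where "m = n - 1 - length arr"
  have n: "n = Suc (length arr + m)" "B * W \<le> m" using assms(1) by (auto simp: m_def)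
  obtain s0 where s0: "s0 \<in> set_pmf (sa_run P G arr (length arr + m))"
    "s \<in> set_pmf (sa_cycle P G (arrivals_at arr (length arr + m)) s0)"
    using assms(2) n by auto
  have "sum remaining (buffer s0) = 0" using drain[OF s0(1)] n(2) by simp
  then show ?thesis using drain_step(2)[OF _ s0] by simp
qed

text \<open>With an empty buffer, \<open>secured\<close> and \<open>flush_secured\<close> both equal
  \<open>gained\<close> and no flush work is outstanding, so the potential is \<open>al + be\<close>
  times the gain minus the offline profit. Here the two weights add up.\<close>

lemma charged_profit_le:
  assumes "length arr + B * W < n"
  shows "sum p {..<n} \<le> (al + be) * measure_pmf.expectation (sa_run P G arr n) (\<lambda>s. real (gained s))"
proof -
  have "potential n s = (al + be) * real (gained s) - sum p {..<n}"
    if "s \<in> set_pmf (sa_run P G arr n)" for s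
    using run_empty[OF assms that]
    by (simp add: potential_def secured_def guaranteed_def GK_items_def flush_items_def
        flush_secured_def flush_work_def total_profit_def algebra_simps)
  then have "measure_pmf.expectation (sa_run P G arr n) (potential n) =
    measure_pmf.expectation (sa_run P G arr n) (\<lambda>s. (al + be) * real (gained s) - sum p {..<n})"
    by (intro integral_cong_AE) (auto simp: AE_measure_pmf_iff)
  also have "\<dots> = (al + be) * measure_pmf.expectation (sa_run P G arr n) (\<lambda>s. real (gained s)) - sum p {..<n}"
    by (simp add: integrable_measure_pmf_finite finite_sa_run)
  finally show ?thesis using expected_potential[of n] by simp
qed

end

section \<open>Offline schedules\<close>

lemma offline_arrivals_props:
  assumes "offline_arrivals B xs S S'" "finite S"
  shows "S' \<subseteq> S \<union> set xs \<and> (card S \<le> B \<longrightarrow> card S' \<le> B)"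
  using assms
proof (induction xs arbitrary: S)
  case (Cons x xs)
  then obtain T where T: "T \<subseteq> insert x S" "card T \<le> B" "offline_arrivals B xs T S'" by auto
  then have "finite T" using Cons.prems(2) finite_subset by blast
  then show ?case using Cons.IH[OF T(3)] T by auto
qed simp

locale offline =
  fixes B :: nat and arr :: arrival_seq and \<sigma> :: "nat \<Rightarrow> item set" and W V M :: nat
  assumes schedule: "offline_schedule B arr \<sigma>"
    and valid_arr: "valid_arrivals W V M arr"
begin

abbreviation pk :: "ident \<Rightarrow> packet" where "pk i \<equiv> arr ! fst i ! snd i"

definition item_valid :: "item \<Rightarrow> bool" where
  "item_valid x \<longleftrightarrow> fst (ident x) < length arr \<and> snd (ident x) < length (arr ! fst (ident x)) \<and>
     pkt x = pk (ident x) \<and> remaining x \<le> work (pkt x)"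

definition buffer_valid :: "nat \<Rightarrow> item set \<Rightarrow> bool" where
  "buffer_valid t S \<longleftrightarrow> finite S \<and> card S \<le> B \<and> inj_on ident S \<and>
     (\<forall>x\<in>S. item_valid x \<and> fst (ident x) < t)"

lemma arrivals_valid:
  assumes "x \<in> set (arrivals_at arr t)"
  shows "item_valid x" "fst (ident x) = t" "remaining x = work (pkt x)"
  using assms by (auto simp: arrivals_at_def item_valid_def split: if_splits)

lemma buffer_valid_arrivals:
  assumes "buffer_valid t S" "offline_arrivals B (arrivals_at arr t) S S'"
  shows "buffer_valid (Suc t) S'" "S' \<subseteq> S \<union> set (arrivals_at arr t)"
proof -
  have S': "S' \<subseteq> S \<union> set (arrivals_at arr t)" "card S' \<le> B"
    using offline_arrivals_props[OF assms(2)] assms(1) by (auto simp: buffer_valid_def)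
  show "S' \<subseteq> S \<union> set (arrivals_at arr t)" by fact
  have "inj_on ident (set (arrivals_at arr t))"
    using distinct_arrival_idents[of arr t] by (simp add: distinct_map)
  moreover have "ident x \<noteq> ident y" if "x \<in> S" "y \<in> set (arrivals_at arr t)" for x y
    using that arrivals_valid(2)[OF that(2)] assms(1) unfolding buffer_valid_def by fastforce
  then have "ident ` S \<inter> ident ` set (arrivals_at arr t) = {}" by blast
  ultimately have "inj_on ident (S \<union> set (arrivals_at arr t))"
    using assms(1) unfolding inj_on_Un buffer_valid_def by blast
  then have "inj_on ident S'" using S'(1) by (rule inj_on_subset)
  moreover have "finite S'"
    by (rule finite_subset[OF S'(1)]) (use assms(1) in \<open>auto simp: buffer_valid_def\<close>)
  moreover have "item_valid x \<and> fst (ident x) < Suc t" if "x \<in> S'" for x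
    using that S'(1) assms(1) arrivals_valid[of x t] by (auto simp: buffer_valid_def less_Suc_eq)
  ultimately show "buffer_valid (Suc t) S'" using S'(2) by (simp add: buffer_valid_def)
qed

lemma offline_process_idents:
  assumes "offline_process S S'"
  shows "ident ` S' = ident ` S"
  using assms by (auto simp: offline_process_def image_iff)

lemma buffer_valid_process:
  assumes "buffer_valid t S" "offline_process S S'"
  shows "buffer_valid t S'"
proof (cases "S' = S")
  case False
  then obtain x where x: "x \<in> S" "S' = insert (process_item x) (S - {x})"
    using assms(2) by (auto simp: offline_process_def)
  have fin: "finite S" and inj: "inj_on ident S" using assms(1) by (auto simp: buffer_valid_def)
  have "card S' \<le> Suc (card (S - {x}))" unfolding x(2) using fin by (simp add: card_insert_if)
  also have "\<dots> = card S" using fin x(1) by (rule card_Suc_Diff1)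
  finally have "card S' \<le> B" using assms(1) by (simp add: buffer_valid_def)
  moreover have "inj_on ident S'" unfolding x(2) using inj x(1) by (auto simp: inj_on_def)
  moreover have "item_valid (process_item x) \<and> fst (ident (process_item x)) < t"
    using assms(1) x(1) by (auto simp: buffer_valid_def item_valid_def)
  ultimately show ?thesis using assms(1) by (auto simp: buffer_valid_def x(2))
qed (use assms in simp)

lemma cycle:
  obtains S where "offline_arrivals B (arrivals_at arr t) (\<sigma> t - finished (\<sigma> t)) S"
    "offline_process S (\<sigma> (Suc t))"
  using schedule unfolding offline_schedule_def by blast

lemma buffer_valid: "buffer_valid t (\<sigma> t)"
proof (induction t)
  case 0
  then show ?case using schedule by (simp add: offline_schedule_def buffer_valid_def)
next
  case (Suc t)
  obtain S where S: "offline_arrivals B (arrivals_at arr t) (\<sigma> t - finished (\<sigma> t)) S"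
    "offline_process S (\<sigma> (Suc t))" by (rule cycle)
  have "card (\<sigma> t - finished (\<sigma> t)) \<le> card (\<sigma> t)"
    using Suc by (intro card_mono) (auto simp: buffer_valid_def)
  then have "buffer_valid t (\<sigma> t - finished (\<sigma> t))"
    using Suc by (auto simp: buffer_valid_def inj_on_diff)
  then show ?case using buffer_valid_arrivals(1) buffer_valid_process S by blast
qed

lemma finite_buffer: "finite (\<sigma> t)" and inj_buffer: "inj_on ident (\<sigma> t)"
  using buffer_valid[of t] by (auto simp: buffer_valid_def)

lemma finite_finished: "finite (finished (\<sigma> t))"
  using finite_buffer[of t] by (simp add: finished_def)

text \<open>Only arrivals of cycle \<open>t\<close> can enter the buffer, and their identities carry
  \<open>t\<close>. So an older packet, once dropped or transmitted, never returns.\<close>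

lemma persist_step:
  assumes "i \<in> ident ` \<sigma> (Suc t)" "fst i \<noteq> t"
  shows "i \<in> ident ` \<sigma> t" "i \<notin> ident ` finished (\<sigma> t)"
proof -
  obtain S where S: "offline_arrivals B (arrivals_at arr t) (\<sigma> t - finished (\<sigma> t)) S"
    "offline_process S (\<sigma> (Suc t))" by (rule cycle)
  have "S \<subseteq> (\<sigma> t - finished (\<sigma> t)) \<union> set (arrivals_at arr t)"
    using offline_arrivals_props[OF S(1)] finite_buffer[of t] by auto
  moreover have "i \<in> ident ` S" using assms(1) offline_process_idents[OF S(2)] by simp
  ultimately obtain x where x: "x \<in> \<sigma> t - finished (\<sigma> t)" "ident x = i"
    using assms(2) arrivals_valid(2)[of _ t] by blast
  then show "i \<in> ident ` \<sigma> t" by auto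
  show "i \<notin> ident ` finished (\<sigma> t)"
  proof
    assume "i \<in> ident ` finished (\<sigma> t)"
    then obtain y where "y \<in> finished (\<sigma> t)" "ident y = ident x" using x(2) by auto
    moreover from this have "y \<in> \<sigma> t" by (simp add: finished_def)
    ultimately show False using inj_onD[OF inj_buffer[of t], of y x] x(1) by auto
  qed
qed

lemma persist:
  assumes "i \<in> ident ` \<sigma> (m + k)" "fst i < m"
  shows "i \<in> ident ` \<sigma> m"
  using assms
proof (induction k)
  case (Suc k)
  then show ?case using persist_step(1)[of i "m + k"] by simp
qed simp

text \<open>Identities instead of items: an item changes whenever it is processed, whereas its
  identity keeps the arrival cycle and, through \<open>pk\<close>, the packet.\<close>

definition completed :: "nat \<Rightarrow> ident set" where
  "completed t = (\<Union>s<t. ident ` finished (\<sigma> s))"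

lemma finite_completed: "finite (completed t)"
  by (simp add: completed_def finite_finished)

lemma completed_Suc: "completed (Suc t) = ident ` finished (\<sigma> t) \<union> completed t"
  by (simp add: completed_def lessThan_Suc)

lemma completed_valid:
  assumes "i \<in> completed t"
  shows "fst i < length arr" "snd i < length (arr ! fst i)"
proof -
  obtain s x where "x \<in> \<sigma> s" "i = ident x"
    using assms by (auto simp: completed_def finished_def)
  then show "fst i < length arr" "snd i < length (arr ! fst i)"
    using buffer_valid[of s] by (auto simp: buffer_valid_def item_valid_def)
qed

text \<open>Presence at a later time would require surviving the transmission step of cycle
  \<open>s\<close>. As a consequence, a sum over \<open>completed\<close> counts each transmitted
  profit exactly once.\<close>

lemma finished_once:
  assumes "s < t" "i \<in> ident ` finished (\<sigma> s)"
  shows "i \<notin> ident ` \<sigma> t"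
proof
  assume t: "i \<in> ident ` \<sigma> t"
  have "fst i < s" using assms(2) buffer_valid[of s] by (auto simp: buffer_valid_def finished_def)
  then have "i \<in> ident ` \<sigma> (Suc s)" using persist[of i "Suc s" "t - Suc s"] t assms(1) by simp
  then show False using persist_step(2) assms(2) \<open>fst i < s\<close> by blast
qed

lemma total_profit_finished: "total_profit (finished (\<sigma> t)) = (\<Sum>i\<in>ident ` finished (\<sigma> t). profit (pk i))"
proof -
  have "inj_on ident (finished (\<sigma> t))"
    using inj_buffer by (rule inj_on_subset) (auto simp: finished_def)
  then have "(\<Sum>i\<in>ident ` finished (\<sigma> t). profit (pk i)) = (\<Sum>x\<in>finished (\<sigma> t). profit (pk (ident x)))"
    by (simp add: sum.reindex)
  also have "\<dots> = total_profit (finished (\<sigma> t))"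
    unfolding total_profit_def using buffer_valid[of t]
    by (intro sum.cong) (auto simp: buffer_valid_def item_valid_def finished_def)
  finally show ?thesis by simp
qed

lemma throughput_completed:
  "(\<Sum>t<n. total_profit (finished (\<sigma> t))) = (\<Sum>i\<in>completed n. profit (pk i))"
proof (induction n)
  case (Suc n)
  have "ident ` finished (\<sigma> n) \<inter> completed n = {}"
    using finished_once[of _ n] by (auto simp: completed_def finished_def)
  then have "(\<Sum>i\<in>completed (Suc n). profit (pk i)) =
      (\<Sum>i\<in>ident ` finished (\<sigma> n). profit (pk i)) + (\<Sum>i\<in>completed n. profit (pk i))"
    unfolding completed_Suc by (intro sum.union_disjoint) (auto simp: finite_finished finite_completed)
  then show ?case using Suc total_profit_finished[of n] by simp
qed (simp add: completed_def)

text \<open>The offline algorithm processes one unit of work per cycle, and the packets arriving from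
  \<open>t0\<close> on receive none of it earlier.\<close>

lemma work_conservation:
  assumes Q: "\<And>q. q \<in> Q \<Longrightarrow> a \<le> work q" and "t0 \<le> t"
  shows "a * card {i \<in> completed t. t0 \<le> fst i \<and> pk i \<in> Q} +
    (\<Sum>x\<in>\<sigma> t. if t0 \<le> fst (ident x) \<and> pkt x \<in> Q then work (pkt x) - remaining x else 0) \<le> t - t0"
  using assms(2)
proof (induction t rule: dec_induct)
  case base
  have "fst i < t0" if i: "i \<in> completed t0" for i
  proof -
    obtain s x where "s < t0" "x \<in> \<sigma> s" "i = ident x"
      using i by (auto simp: completed_def finished_def)
    then show ?thesis using buffer_valid[of s] by (auto simp: buffer_valid_def)
  qed
  then have empty: "{i \<in> completed t0. t0 \<le> fst i \<and> pk i \<in> Q} = {}" by force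
  moreover have "(\<Sum>x\<in>\<sigma> t0. if t0 \<le> fst (ident x) \<and> pkt x \<in> Q then work (pkt x) - remaining x else 0) = 0"
    using buffer_valid[of t0] by (intro sum.neutral) (auto simp: buffer_valid_def)
  ultimately show ?case by (simp only: empty) simp
next
  case (step t)
  define g :: "item \<Rightarrow> nat" where "g x = (if t0 \<le> fst (ident x) \<and> pkt x \<in> Q then work (pkt x) - remaining x else 0)" for x
  let ?F = "finished (\<sigma> t)"
  define D where "D = {x \<in> ?F. t0 \<le> fst (ident x) \<and> pkt x \<in> Q}"
  obtain S where S: "offline_arrivals B (arrivals_at arr t) (\<sigma> t - ?F) S"
    "offline_process S (\<sigma> (Suc t))" by (rule cycle)
  have Ssub: "S \<subseteq> (\<sigma> t - ?F) \<union> set (arrivals_at arr t)"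
    using offline_arrivals_props[OF S(1)] finite_buffer[of t] by auto
  then have finS: "finite S" by (rule finite_subset) (simp add: finite_buffer)
  have "sum g (\<sigma> (Suc t)) \<le> Suc (sum g S)"
  proof (cases "\<sigma> (Suc t) = S")
    case False
    then obtain x where x: "x \<in> S" "\<sigma> (Suc t) = insert (process_item x) (S - {x})"
      using S(2) by (auto simp: offline_process_def)
    have "sum g (\<sigma> (Suc t)) \<le> g (process_item x) + sum g (S - {x})"
      unfolding x(2) using finS by (simp add: sum.insert_if)
    also have "g (process_item x) \<le> Suc (g x)" by (auto simp: g_def)
    finally show ?thesis using sum.remove[OF finS x(1), of g] by simp
  qed simp
  also have "sum g S \<le> sum g ((\<sigma> t - ?F) \<union> set (arrivals_at arr t))"
    using Ssub by (intro sum_mono2) (auto simp: finite_buffer)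
  \<comment> \<open>New arrivals have received no processing and contribute 0 to
    \<open>g\<close>.\<close>
  also have "\<dots> = sum g (\<sigma> t - ?F)"
  proof (rule sum.mono_neutral_right)
    show "\<forall>x\<in>(\<sigma> t - ?F) \<union> set (arrivals_at arr t) - (\<sigma> t - ?F). g x = 0"
      using arrivals_valid(3)[of _ t] by (auto simp: g_def)
  qed (auto simp: finite_buffer)
  finally have 1: "sum g (\<sigma> (Suc t)) \<le> Suc (sum g (\<sigma> t - ?F))" by simp
  have "a * card D = (\<Sum>x\<in>D. a)" by simp
  \<comment> \<open>A finished packet has received all of its work, which is at least
    \<open>a\<close> in \<open>Q\<close>: its share moves from the buffer term to the term counting
    completed packets.\<close>
  also have "\<dots> \<le> sum g D"
    by (rule sum_mono) (use Q in \<open>auto simp: g_def D_def finished_def\<close>)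
  also have "\<dots> \<le> sum g ?F"
    by (rule sum_mono2) (auto simp: finite_finished D_def)
  finally have 2: "a * card D \<le> sum g ?F" .
  have 3: "sum g (\<sigma> t) = sum g (\<sigma> t - ?F) + sum g ?F"
    by (rule sum.subset_diff) (auto simp: finished_def finite_buffer)
  have "{i \<in> completed (Suc t). t0 \<le> fst i \<and> pk i \<in> Q} \<subseteq>
    ident ` D \<union> {i \<in> completed t. t0 \<le> fst i \<and> pk i \<in> Q}"
  proof
    fix i assume i: "i \<in> {i \<in> completed (Suc t). t0 \<le> fst i \<and> pk i \<in> Q}"
    show "i \<in> ident ` D \<union> {i \<in> completed t. t0 \<le> fst i \<and> pk i \<in> Q}"
    proof (cases "i \<in> completed t")
      case False
      then obtain x where x: "x \<in> ?F" "ident x = i" using i by (auto simp: completed_Suc)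
      then have "pkt x = pk i"
        using buffer_valid[of t] by (auto simp: buffer_valid_def item_valid_def finished_def)
      then have "x \<in> D" using x i by (simp add: D_def)
      then show ?thesis using x(2) by blast
    qed (use i in simp)
  qed
  then have "card {i \<in> completed (Suc t). t0 \<le> fst i \<and> pk i \<in> Q} \<le>
      card (ident ` D \<union> {i \<in> completed t. t0 \<le> fst i \<and> pk i \<in> Q})"
    by (intro card_mono) (auto simp: finite_completed finite_finished D_def)
  also have "\<dots> \<le> card (ident ` D) + card {i \<in> completed t. t0 \<le> fst i \<and> pk i \<in> Q}"
    by (rule card_Un_le)
  also have "card (ident ` D) \<le> card D"
    by (rule card_image_le) (simp add: finite_finished D_def)
  finally have "card {i \<in> completed (Suc t). t0 \<le> fst i \<and> pk i \<in> Q} \<le>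
    card D + card {i \<in> completed t. t0 \<le> fst i \<and> pk i \<in> Q}" by simp
  from mult_le_mono2[OF this, of a]
  have "a * card {i \<in> completed (Suc t). t0 \<le> fst i \<and> pk i \<in> Q} \<le>
    a * card D + a * card {i \<in> completed t. t0 \<le> fst i \<and> pk i \<in> Q}"
    by (simp only: distrib_left)
  then have "a * card {i \<in> completed (Suc t). t0 \<le> fst i \<and> pk i \<in> Q} + sum g (\<sigma> (Suc t)) \<le>
      Suc (a * card {i \<in> completed t. t0 \<le> fst i \<and> pk i \<in> Q} + sum g (\<sigma> t))"
    using 1 2 3 by linarith
  also have "\<dots> \<le> Suc t - t0" using step by (simp add: g_def[abs_def] Suc_diff_le)
  finally show ?case by (simp add: g_def[abs_def])
qed

text \<open>A packet that arrived in the window and is completed at some time either was completed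
  within the window, which cost at least \<open>a\<close> of the \<open>L\<close> available cycles,
  or still sits in the buffer at its end, where there are at most \<open>B\<close> packets.\<close>

lemma completed_in_window:
  assumes Q: "\<And>q. q \<in> Q \<Longrightarrow> a \<le> work q"
  shows "a * card {i \<in> completed n. fst i \<in> {t0..<t0 + L} \<and> pk i \<in> Q} \<le> L + a * B"
proof -
  let ?C = "{i \<in> completed (t0 + L). t0 \<le> fst i \<and> pk i \<in> Q}"
  have "{i \<in> completed n. fst i \<in> {t0..<t0 + L} \<and> pk i \<in> Q} \<subseteq> ?C \<union> ident ` \<sigma> (t0 + L)"
  proof
    fix i assume i: "i \<in> {i \<in> completed n. fst i \<in> {t0..<t0 + L} \<and> pk i \<in> Q}"
    then obtain s where s: "i \<in> ident ` finished (\<sigma> s)" by (auto simp: completed_def)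
    show "i \<in> ?C \<union> ident ` \<sigma> (t0 + L)"
    proof (cases "s < t0 + L")
      case True
      then have "i \<in> completed (t0 + L)" using s unfolding completed_def by blast
      then show ?thesis using i by simp
    next
      case False
      have "i \<in> ident ` \<sigma> (t0 + L + (s - (t0 + L)))" using s False by (auto simp: finished_def)
      then have "i \<in> ident ` \<sigma> (t0 + L)" by (rule persist) (use i in simp)
      then show ?thesis by simp
    qed
  qed
  then have "card {i \<in> completed n. fst i \<in> {t0..<t0 + L} \<and> pk i \<in> Q} \<le> card (?C \<union> ident ` \<sigma> (t0 + L))"
    by (intro card_mono) (auto simp: finite_completed finite_buffer)
  also have "\<dots> \<le> card ?C + card (ident ` \<sigma> (t0 + L))" by (rule card_Un_le)
  also have "card (ident ` \<sigma> (t0 + L)) \<le> card (\<sigma> (t0 + L))" by (rule card_image_le) (rule finite_buffer)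
  also have "\<dots> \<le> B" using buffer_valid[of "t0 + L"] by (simp add: buffer_valid_def)
  finally have "a * card {i \<in> completed n. fst i \<in> {t0..<t0 + L} \<and> pk i \<in> Q} \<le> a * (card ?C + B)"
    by (intro mult_le_mono2) simp
  also have "\<dots> \<le> L + a * B"
    using work_conservation[of Q a t0 "t0 + L", OF Q] by (simp add: distrib_left)
  finally show ?thesis .
qed

text \<open>Indexed by the cycle of arrival rather than of completion, since the online account pays
  for packets when they arrive. The horizon \<open>n\<close> keeps the sums finite.\<close>

definition class_profit :: "nat \<Rightarrow> packet set \<Rightarrow> nat \<Rightarrow> nat" where
  "class_profit n Q t = (\<Sum>i\<in>{i \<in> completed n. fst i = t \<and> pk i \<in> Q}. profit (pk i))"

lemma sum_class_profit:
  assumes "finite T"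
  shows "sum (class_profit n Q) T = (\<Sum>i\<in>{i \<in> completed n. fst i \<in> T \<and> pk i \<in> Q}. profit (pk i))"
proof -
  have "{i \<in> completed n. fst i \<in> T \<and> pk i \<in> Q} = (\<Union>t\<in>T. {i \<in> completed n. fst i = t \<and> pk i \<in> Q})"
    by auto
  then show ?thesis
    unfolding class_profit_def using assms
    by (simp only:) (rule sum.UNION_disjoint[symmetric]; auto simp: finite_completed)
qed

lemma class_profit_window:
  assumes Q: "\<And>q. q \<in> Q \<Longrightarrow> a \<le> work q \<and> profit q \<le> d"
  shows "a * sum (class_profit n Q) {t0..<t0 + L} \<le> d * (L + a * B)"
proof -
  let ?R = "{i \<in> completed n. fst i \<in> {t0..<t0 + L} \<and> pk i \<in> Q}"
  have "sum (class_profit n Q) {t0..<t0 + L} \<le> (\<Sum>i\<in>?R. d)"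
    unfolding sum_class_profit[OF finite_atLeastLessThan] by (rule sum_mono) (use Q in auto)
  then have "a * sum (class_profit n Q) {t0..<t0 + L} \<le> a * (card ?R * d)"
    by (intro mult_le_mono2) simp
  also have "\<dots> = d * (a * card ?R)" by (simp add: mult_ac)
  also have "\<dots> \<le> d * (L + a * B)"
    by (intro mult_le_mono2 completed_in_window) (use Q in auto)
  finally show ?thesis .
qed

lemma class_profit_arrivals:
  assumes "Q \<subseteq> G"
  shows "class_profit n Q t \<le> (\<Sum>x\<leftarrow>arrivals_at arr t. if pkt x \<in> G then profit (pkt x) else 0)"
proof (cases "t < length arr")
  case True
  let ?A = "{i \<in> completed n. fst i = t \<and> pk i \<in> Q}"
  have inj: "inj_on snd ?A" by (auto simp: inj_on_def prod_eq_iff)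
  have "class_profit n Q t = (\<Sum>k\<in>snd ` ?A. profit (arr ! t ! k))"
    unfolding class_profit_def sum.reindex[OF inj] by (intro sum.cong) auto
  also have "\<dots> = (\<Sum>k\<in>snd ` ?A. if arr ! t ! k \<in> G then profit (arr ! t ! k) else 0)"
    using assms by (intro sum.cong) auto
  also have "\<dots> \<le> (\<Sum>k\<in>{0..<length (arr ! t)}. if arr ! t ! k \<in> G then profit (arr ! t ! k) else 0)"
    by (rule sum_mono2) (use completed_valid(2)[of _ n] in auto)
  also have "\<dots> = (\<Sum>x\<leftarrow>arrivals_at arr t. if pkt x \<in> G then profit (pkt x) else 0)"
    using True by (simp add: arrivals_at_def comp_def interv_sum_list_conv_sum_set_nat cong: if_cong)
  finally show ?thesis .
next
  case False
  then have empty: "{i \<in> completed n. fst i = t \<and> pk i \<in> Q} = {}"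
    using completed_valid(1)[of _ n] by auto
  show ?thesis unfolding class_profit_def empty by simp
qed

lemma sum_class_profit_all:
  assumes "length arr \<le> m"
  shows "sum (class_profit n Q) {..<m} = (\<Sum>i\<in>{i \<in> completed n. pk i \<in> Q}. profit (pk i))"
proof -
  have "{i \<in> completed n. fst i \<in> {..<m} \<and> pk i \<in> Q} = {i \<in> completed n. pk i \<in> Q}"
    using completed_valid(1)[of _ n] assms by fastforce
  then show ?thesis by (simp add: sum_class_profit)
qed

end

section \<open>Competitiveness\<close>

lemma sum_UN_le:
  fixes f :: "'a \<Rightarrow> nat"
  assumes "finite I" "\<And>i. i \<in> I \<Longrightarrow> finite (A i)"
  shows "sum f (\<Union>i\<in>I. A i) \<le> (\<Sum>i\<in>I. sum f (A i))"
  using assms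
proof (induction I rule: finite_induct)
  case (insert i I)
  have "sum f (A i \<union> (\<Union>i\<in>I. A i)) \<le> sum f (A i) + sum f (\<Union>i\<in>I. A i)"
    using insert by (subst sum_Un_nat) auto
  then show ?case using insert by fastforce
qed simp

text \<open>Since classes are ordered, the upper end of class \<open>i\<close> also bounds all lower
  classes and its lower end all higher ones. The first fact serves the work side of a closure class,
  the second its profit side.\<close>

lemma range_partitionD:
  assumes "range_partition N l C" "i \<in> {1..l}"
  obtains a b where "C i = {a..b}" "1 \<le> a" "a \<le> b"
    "\<And>i' x. i' \<in> {1..i} \<Longrightarrow> x \<in> C i' \<Longrightarrow> x \<le> b"
    "\<And>i' x. i' \<in> {i..l} \<Longrightarrow> x \<in> C i' \<Longrightarrow> a \<le> x"
proof -
  have "\<exists>a b. a \<le> b \<and> C i = {a..b}"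
    using assms(1) unfolding range_partition_def by (elim conjE) (rule bspec[OF _ assms(2)])
  then obtain a b where ab: "a \<le> b" "C i = {a..b}" by auto
  have "a \<in> (\<Union>i\<in>{1..l}. C i)" by (rule UN_I[OF assms(2)]) (simp add: ab)
  moreover have "(\<Union>i\<in>{1..l}. C i) = {1..N}"
    using assms(1) unfolding range_partition_def by (elim conjE)
  ultimately have "a \<in> {1..N}" by (simp only:)
  then have "1 \<le> a" by simp
  have mem: "a \<in> C i" "b \<in> C i" using ab by auto
  have less: "x < y" if "i' \<in> {1..l}" "j \<in> {1..l}" "i' < j" "x \<in> C i'" "y \<in> C j" for i' j x y
    using assms(1) that unfolding range_partition_def by blast
  have "x \<le> b" if "i' \<in> {1..i}" "x \<in> C i'" for i' x
  proof (cases "i' = i")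
    case False
    then show ?thesis using less[of i' i x b] that mem assms(2) by auto
  qed (use that ab in auto)
  moreover have "a \<le> x" if "i' \<in> {i..l}" "x \<in> C i'" for i' x
  proof (cases "i' = i")
    case False
    then show ?thesis using less[of i i' a x] that mem assms(2) by auto
  qed (use that ab in auto)
  ultimately show ?thesis using that[OF ab(2) \<open>1 \<le> a\<close> ab(1)] by blast
qed

lemma ratio_le_max_ratio:
  assumes "range_partition N l C" "i \<in> {1..l}" "x \<in> C i" "y \<in> C i"
  shows "real x / real y \<le> max_ratio l C"
proof -
  let ?S = "{real x / real y | x y i. i \<in> {1..l} \<and> x \<in> C i \<and> y \<in> C i}"
  have sub: "C i \<subseteq> {1..N}" if "i \<in> {1..l}" for i
    using assms(1) that unfolding range_partition_def by blast
  have "?S \<subseteq> (\<lambda>(x, y). real x / real y) ` ({1..N} \<times> {1..N})"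
  proof
    fix z assume "z \<in> ?S"
    then obtain x y i where "z = real x / real y" "i \<in> {1..l}" "x \<in> C i" "y \<in> C i" by blast
    moreover from this have "x \<in> {1..N}" "y \<in> {1..N}" using sub by blast+
    ultimately show "z \<in> (\<lambda>(x, y). real x / real y) ` ({1..N} \<times> {1..N})"
      by (auto intro!: image_eqI[of _ _ "(x, y)"])
  qed
  then have "finite ?S" by (rule finite_subset) simp
  moreover have "real x / real y \<in> ?S" using assms by blast
  ultimately show ?thesis unfolding max_ratio_def by (rule Max_ge)
qed

lemma range_partition_nonempty:
  assumes "range_partition N l C" "1 \<le> N"
  shows "1 \<le> l"
proof (rule ccontr)
  assume "\<not> 1 \<le> l"
  then have "{1..l} = {}" by simp
  then have "{1..N} = {}" using assms(1) unfolding range_partition_def by (metis UN_empty)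
  then show False using assms(2) by simp
qed

lemma closure_class_bounds:
  assumes "range_partition W lW CW" "range_partition V lV CV" "i \<in> {1..lW}" "j \<in> {1..lV}"
  obtains a b c d where "CW i = {a..b}" "1 \<le> a" "a \<le> b" "CV j = {c..d}" "1 \<le> c" "c \<le> d"
    "\<And>q. q \<in> closure_class CW lV CV i j \<Longrightarrow> work q \<le> b \<and> c \<le> profit q"
proof -
  obtain a b where ab: "CW i = {a..b}" "1 \<le> a" "a \<le> b"
    "\<And>i' x. i' \<in> {1..i} \<Longrightarrow> x \<in> CW i' \<Longrightarrow> x \<le> b"
    using range_partitionD[OF assms(1,3)] by metis
  obtain c d where cd: "CV j = {c..d}" "1 \<le> c" "c \<le> d"
    "\<And>j' x. j' \<in> {j..lV} \<Longrightarrow> x \<in> CV j' \<Longrightarrow> c \<le> x"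
    using range_partitionD[OF assms(2,4)] by metis
  show ?thesis
    by (rule that[OF ab(1-3) cd(1-3)])
      (use ab(4) cd(4) in \<open>auto simp: closure_class_def packet_class_def\<close>)
qed

lemma packet_class_subset_closure:
  assumes "i \<in> {1..lW}" "j \<in> {1..lV}"
  shows "packet_class CW CV i j \<subseteq> closure_class CW lV CV i j"
proof -
  have "i \<in> {1..i}" "j \<in> {j..lV}" using assms by auto
  then show ?thesis unfolding closure_class_def by blast
qed

text \<open>Offline and online profit meet at the endpoints of one class: offline packets from
  \<open>packet_class\<close> have work at least a and profit at most d, online packets from the
  larger closure have work at most b and profit at least c. The horizons are independent:
  \<open>N\<close> truncates the offline schedule, while \<open>n\<close> only has to be late enough
  for the online buffer to be empty.\<close>

lemma class_competitive:
  assumes arr: "valid_arrivals W V M arr" and \<sigma>: "offline_schedule (capacity P) arr \<sigma>"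
    and M: "1 \<le> M" and P: "valid_sa_params P"
    and CW: "range_partition W lW CW" "i \<in> {1..lW}" and CV: "range_partition V lV CV" "j \<in> {1..lV}"
    and n: "length arr + capacity P * W < n"
  shows "real (\<Sum>x\<in>{x \<in> offline.completed \<sigma> N. arr ! fst x ! snd x \<in> packet_class CW CV i j}.
      profit (arr ! fst x ! snd x)) \<le>
    (real M / admit_prob P + 2 * (max_ratio lW CW * max_ratio lV CV)) *
    measure_pmf.expectation (sa_run P (closure_class CW lV CV i j) arr n) (\<lambda>s. real (gained s))"
    (is "?l \<le> (?al + 2 * (?dW * ?dV)) * ?E")
proof -
  interpret offline "capacity P" arr \<sigma> W V M by unfold_locales fact+
  let ?G = "closure_class CW lV CV i j"
  let ?Q = "packet_class CW CV i j"
  obtain a b c d where bounds: "CW i = {a..b}" "1 \<le> a" "a \<le> b" "CV j = {c..d}" "1 \<le> c" "c \<le> d"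
    "\<And>q. q \<in> ?G \<Longrightarrow> work q \<le> b \<and> c \<le> profit q"
    using closure_class_bounds[OF CW(1) CV(1) CW(2) CV(2)] by metis
  let ?B = "capacity P"
  have r: "0 < admit_prob P" "admit_prob P \<le> 1" using P by (auto simp: valid_sa_params_def)
  have ba: "real b / real a \<le> ?dW" and dc: "real d / real c \<le> ?dV"
    using ratio_le_max_ratio[OF CW(1,2), of b a] ratio_le_max_ratio[OF CV(1,2), of d c] bounds by auto
  have a1: "1 \<le> ?dW" using ratio_le_max_ratio[OF CW(1,2), of a a] bounds by auto
  have c1: "1 \<le> ?dV" using ratio_le_max_ratio[OF CV(1,2), of c c] bounds by auto
  define p where "p t = real (class_profit N ?Q t)" for t
  have budget: "sum p {t..<t + L} \<le> 2 * (?dW * ?dV) * real (?B * c)" if L: "L \<le> ?B * b" for t L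
  proof -
    have "a * sum (class_profit N ?Q) {t..<t + L} \<le> d * (L + a * ?B)"
      by (rule class_profit_window) (use bounds in \<open>auto simp: packet_class_def\<close>)
    also have "\<dots> \<le> d * (?B * b + a * ?B)" using L by (intro mult_le_mono2) simp
    finally have "real a * sum p {t..<t + L} \<le> real (d * (?B * b + a * ?B))"
      unfolding p_def by (metis of_nat_le_iff of_nat_mult of_nat_sum)
    then have "sum p {t..<t + L} \<le> real (d * (?B * b + a * ?B)) / real a"
      using bounds(2) by (simp add: field_simps)
    \<comment> \<open>Expands by \<open>c\<close> in order to compare with \<open>?B * c\<close>,
      the least profit of a flush phase.\<close>
    also have "\<dots> = (real d / real c) * (real b / real a + 1) * real (?B * c)"
      using bounds(2,5) by (simp add: field_simps)
    \<comment> \<open>The summand \<open>b / a\<close> stands for packets completed during the flush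
      phase, the summand 1 for those left in the offline buffer. As the ratio is at least 1 it also
      absorbs the latter, which is the origin of the factor 2.\<close>
    also have "\<dots> \<le> ?dV * (?dW + ?dW) * real (?B * c)"
      using ba dc a1 c1 by (intro mult_right_mono mult_mono add_mono) auto
    finally show ?thesis by (simp add: algebra_simps)
  qed
  interpret charged_run P ?G arr W b c p ?al "2 * (?dW * ?dV)" M V
  proof unfold_locales
    show "p t \<le> real (\<Sum>x\<leftarrow>arrivals_at arr t. if pkt x \<in> ?G then profit (pkt x) else 0)" for t
      unfolding p_def using class_profit_arrivals[OF packet_class_subset_closure[OF CW(2) CV(2)]]
      by (intro of_nat_mono)
    show "1 \<le> ?al" using r M by (simp add: field_simps)
    show "real M \<le> ?al * admit_prob P" using r by simp
    show "0 \<le> 2 * (?dW * ?dV)" using a1 c1 by simp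
    show "0 \<le> p t" for t by (simp add: p_def)
  qed (use P bounds(7) budget arr in auto)
  have "?l = sum p {..<n}"
    unfolding p_def using sum_class_profit_all[of n N ?Q] n by (simp only: flip: of_nat_sum)
  also have "\<dots> \<le> (?al + 2 * (?dW * ?dV)) * ?E" by (rule charged_profit_le[OF n])
  finally show ?thesis .
qed

section \<open>Averaging over the selected class\<close>

lemma expectation_sa_star:
  fixes f :: "sa_state \<Rightarrow> real"
  assumes "1 \<le> lW" "1 \<le> lV"
  shows "real lW * real lV * measure_pmf.expectation (sa_star P lW CW lV CV arr n) f =
    (\<Sum>i\<in>{1..lW}. \<Sum>j\<in>{1..lV}.
      measure_pmf.expectation (sa_run P (closure_class CW lV CV i j) arr n) f)"
proof -
  have fin: "finite (set_pmf (pmf_of_set {1..l}))" if "1 \<le> l" for l :: nat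
    using that by (subst set_pmf_of_set) auto
  have "measure_pmf.expectation (sa_star P lW CW lV CV arr n) f =
    (\<Sum>i\<in>{1..lW}. (\<Sum>j\<in>{1..lV}.
      measure_pmf.expectation (sa_run P (closure_class CW lV CV i j) arr n) f) / real lV) / real lW"
    unfolding sa_star_def using assms
    by (simp add: expectation_bind_finite fin finite_sa_run integral_pmf_of_set
        sum_divide_distrib[symmetric])
  then show ?thesis using assms by (simp add: sum_divide_distrib[symmetric])
qed

theorem theorem13:
  shows "\<exists>C::real. C > 0 \<and>
    (\<forall>(W::nat) (V::nat) (M::nat) (lW::nat) (lV::nat) (CW::nat \<Rightarrow> nat set) (CV::nat \<Rightarrow> nat set)
       (P::sa_params).
      W > 1 \<longrightarrow> V > 1 \<longrightarrow> M \<ge> 1 \<longrightarrow>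
      range_partition W lW CW \<longrightarrow> range_partition V lV CV \<longrightarrow>
      valid_sa_params P \<longrightarrow>
      competitive W V M (capacity P) (sa_expected_throughput P lW CW lV CV)
        (C * (real M / admit_prob P + max_ratio lW CW * max_ratio lV CV) * real lW * real lV))"
proof (intro exI[of _ 2] conjI allI impI)
  fix W V M lW lV CW CV P
  assume W: "W > (1::nat)" and V: "V > (1::nat)" and M: "M \<ge> (1::nat)"
    and CW: "range_partition W lW CW" and CV: "range_partition V lV CV" and P: "valid_sa_params P"
  let ?K = "real M / admit_prob P + max_ratio lW CW * max_ratio lV CV"
  show "competitive W V M (capacity P) (sa_expected_throughput P lW CW lV CV)
    (2 * ?K * real lW * real lV)"
    unfolding competitive_def
  proof (intro allI impI)
    fix arr \<sigma>
    assume arr: "valid_arrivals W V M arr" and \<sigma>: "offline_schedule (capacity P) arr \<sigma>"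
    interpret offline "capacity P" arr \<sigma> W V M by unfold_locales fact+
    \<comment> \<open>The first horizon with a surely empty online buffer. It does not depend on the
      offline horizon \<open>N\<close>, so one value \<open>E\<close> bounds all partial sums of the
      offline throughput.\<close>
    define n where "n = Suc (length arr + capacity P * W)"
    define E where "E = measure_pmf.expectation (sa_star P lW CW lV CV arr n) (\<lambda>s. real (gained s))"
    let ?pr = "\<lambda>x. profit (arr ! fst x ! snd x)"
    let ?X = "\<lambda>N i j. {x \<in> completed N. arr ! fst x ! snd x \<in> packet_class CW CV i j}"
    have l: "1 \<le> lW" "1 \<le> lV"
      using range_partition_nonempty[OF CW] range_partition_nonempty[OF CV] W V by auto
    have al: "0 \<le> real M / admit_prob P" using P by (simp add: valid_sa_params_def)
    \<comment> \<open>Only the ratio term carries the factor 2; doubling the \<open>M\<close>/r term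
      as well yields a common constant.\<close>
    have add_double_le: "x + 2 * y \<le> 2 * (x + y)" if "0 \<le> x" for x y :: real
      using that by simp
    have E0: "0 \<le> measure_pmf.expectation q (\<lambda>s. real (gained s))" for q
      by (intro Bochner_Integration.integral_nonneg) simp
    have bound: "real (\<Sum>t<N. total_profit (finished (\<sigma> t))) \<le> 2 * ?K * real lW * real lV * E" for N
    proof -
      have cover: "x \<in> (\<Union>i\<in>{1..lW}. \<Union>j\<in>{1..lV}. ?X N i j)" if x: "x \<in> completed N" for x
      proof -
        have "work (arr ! fst x ! snd x) \<in> (\<Union>i\<in>{1..lW}. CW i)"
          "profit (arr ! fst x ! snd x) \<in> (\<Union>j\<in>{1..lV}. CV j)"
          using valid_arrivals_nth[OF arr completed_valid[OF x]] CW CV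
          unfolding range_partition_def by simp_all
        then show ?thesis using x by (auto simp: packet_class_def)
      qed
      have "(\<Sum>t<N. total_profit (finished (\<sigma> t))) = sum ?pr (completed N)"
        by (rule throughput_completed)
      also have "\<dots> \<le> sum ?pr (\<Union>i\<in>{1..lW}. \<Union>j\<in>{1..lV}. ?X N i j)"
        by (rule sum_mono2) (use cover finite_completed[of N] in auto)
      also have "\<dots> \<le> (\<Sum>i\<in>{1..lW}. sum ?pr (\<Union>j\<in>{1..lV}. ?X N i j))"
        by (rule sum_UN_le) (auto simp: finite_completed)
      also have "\<dots> \<le> (\<Sum>i\<in>{1..lW}. \<Sum>j\<in>{1..lV}. sum ?pr (?X N i j))"
        by (intro sum_mono sum_UN_le) (auto simp: finite_completed)
      finally have "real (\<Sum>t<N. total_profit (finished (\<sigma> t))) \<le>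
          (\<Sum>i\<in>{1..lW}. \<Sum>j\<in>{1..lV}. real (sum ?pr (?X N i j)))"
        by (simp flip: of_nat_sum)
      also have "\<dots> \<le> (\<Sum>i\<in>{1..lW}. \<Sum>j\<in>{1..lV}. 2 * ?K *
          measure_pmf.expectation (sa_run P (closure_class CW lV CV i j) arr n) (\<lambda>s. real (gained s)))"
      proof (intro sum_mono)
        fix i j assume ij: "i \<in> {1..lW}" "j \<in> {1..lV}"
        have "real (sum ?pr (?X N i j)) \<le>
          (real M / admit_prob P + 2 * (max_ratio lW CW * max_ratio lV CV)) *
          measure_pmf.expectation (sa_run P (closure_class CW lV CV i j) arr n) (\<lambda>s. real (gained s))"
          by (rule class_competitive[OF arr \<sigma> M P CW ij(1) CV ij(2)]) (simp add: n_def)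
        also have "\<dots> \<le> 2 * ?K *
          measure_pmf.expectation (sa_run P (closure_class CW lV CV i j) arr n) (\<lambda>s. real (gained s))"
          by (intro mult_right_mono E0) (rule add_double_le[OF al])
        finally show "real (sum ?pr (?X N i j)) \<le> 2 * ?K *
          measure_pmf.expectation (sa_run P (closure_class CW lV CV i j) arr n) (\<lambda>s. real (gained s))" .
      qed
      also have "\<dots> = 2 * ?K * (real lW * real lV * E)"
        unfolding E_def expectation_sa_star[OF l] by (simp only: sum_distrib_left)
      finally show ?thesis by (simp only: mult.assoc)
    qed
    have fin: "finite (set_pmf (sa_star P lW CW lV CV arr n))"
      using l by (simp add: sa_star_def finite_sa_run set_pmf_of_set)
    have "ennreal E = (\<integral>\<^sup>+ s. of_nat (gained s) \<partial>measure_pmf (sa_star P lW CW lV CV arr n))"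
      unfolding E_def
      by (subst nn_integral_eq_integral[symmetric])
        (auto simp: integrable_measure_pmf_finite[OF fin] ennreal_of_nat_eq_real_of_nat)
    also have "\<dots> \<le> sa_expected_throughput P lW CW lV CV arr"
      unfolding sa_expected_throughput_def by (rule SUP_upper) simp
    finally have E: "ennreal E \<le> sa_expected_throughput P lW CW lV CV arr" .
    have "offline_throughput \<sigma> = (SUP N. \<Sum>t<N. of_nat (total_profit (finished (\<sigma> t))))"
      unfolding offline_throughput_def by (rule suminf_eq_SUP)
    also have "\<dots> \<le> ennreal (2 * ?K * real lW * real lV) * ennreal E"
    proof (rule SUP_least)
      fix N
      have "(\<Sum>t<N. of_nat (total_profit (finished (\<sigma> t)))) =
          of_nat (\<Sum>t<N. total_profit (finished (\<sigma> t)))"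
        by (rule of_nat_sum[symmetric])
      also have "\<dots> = ennreal (real (\<Sum>t<N. total_profit (finished (\<sigma> t))))"
        by (rule ennreal_of_nat_eq_real_of_nat)
      also have "\<dots> \<le> ennreal (2 * ?K * real lW * real lV * E)"
        by (rule ennreal_leI[OF bound])
      also have "\<dots> = ennreal (2 * ?K * real lW * real lV) * ennreal E"
        using E0 by (intro ennreal_mult'') (simp add: E_def)
      finally show "(\<Sum>t<N. of_nat (total_profit (finished (\<sigma> t)))) \<le>
        ennreal (2 * ?K * real lW * real lV) * ennreal E" .
    qed
    also have "\<dots> \<le> ennreal (2 * ?K * real lW * real lV) * sa_expected_throughput P lW CW lV CV arr"
      by (rule mult_left_mono[OF E]) simp
    finally show "offline_throughput \<sigma> \<le>
      ennreal (2 * ?K * real lW * real lV) * sa_expected_throughput P lW CW lV CV arr" .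
  qed
qed simp

end
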